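(* Consider a system of $\overline m$ differential equations $$F_{\bar\alpha}\big(x,u,u_{(1)},\ldots,u_{(s)}\big)=0,\qquad \bar\alpha=1,\ldots,\overline m, \tag{S}$$ with $n$ independent variables $x=(x^1,\ldots,x^n)$ and $m$ dependent variables $u=(u^1,\ldots,u^m)$ ($\overline m$ and $m$ may be different). Suppose (S) is nonlinearly self-adjoint; specifically, suppose that the adjoint system $$\frac{\delta (v^{\bar\beta}F_{\bar\beta})}{\delta u^\alpha}=0,\qquad \alpha=1,\ldots,m,$$ is satisfied for all solutions $u$ of (S) upon a substitution $v^{\bar\alpha}=\varphi^{\bar\alpha}(x,u)$, $\bar\alpha=1,\ldots,\overline m$, where not all $\varphi^{\bar\alpha}$ vanish identically. Then any Lie point, contact or Lie–Bäcklund symmetry $$X=\xi^i(x,u,u_{(1)},\ldots)\frac{\partial}{\partial x^i}+\eta^\alpha(x,u,u_{(1)},\ldots)\frac{\partial}{\partial u^\alpha}$$ of (S), as well as any nonlocal symmetry of (S), leads to a conservation law $$\big[D_i(C^i)\big]_{(S)}=0,$$ where, with $\mathcal L=v^{\bar\beta}F_{\bar\beta}$ and $W^\alpha=\eta^\alpha-\xi^ju^\alpha_j$, the components $C^i$ ($i=1,\ldots,n$) are given by $$\begin{aligned} C^i={}&\xi^i\mathcal L+W^\alpha\Big[\frac{\partial\mathcal L}{\partial u^\alpha_i}-D_j\Big(\frac{\partial\mathcal L}{\partial u^\alpha_{ij}}\Big)+D_jD_k\Big(\frac{\partial\mathcal L}{\partial u^\alpha_{ijk}}\Big)-\cdots\Big]\\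 &+D_j(W^\alpha)\Big[\frac{\partial\mathcal L}{\partial u^\alpha_{ij}}-D_k\Big(\frac{\partial\mathcal L}{\partial u^\alpha_{ijk}}\Big)+\cdots\Big]+D_jD_k(W^\alpha)\Big[\frac{\partial\mathcal L}{\partial u^\alpha_{ijk}}-\cdots\Big]+\cdots. \end{aligned}$$ Here $\mathcal L$ is written in symmetric form with respect to all mixed derivatives $u^\alpha_{ij},u^\alpha_{ijk},\ldots$, and the variables $v^{\bar\alpha}$ are eliminated from $C^i$ via $v^{\bar\alpha}=\varphi^{\bar\alpha}(x,u)$.
   Context: Summation over repeated indices is understood. $u_{(1)}=\{u^\alpha_i\}$, $u_{(2)}=\{u^\alpha_{ij}\},\ldots$ denote the sets of partial derivatives of $u$ of order $1,2,\ldots$. A differential function is a locally analytic function of finitely many of the variables $x,u,u_{(1)},u_{(2)},\ldots$; the $F_{\bar\alpha}$ are differential functions. The $v=(v^1,\ldots,v^{\overline m})$ are auxiliary dependent variables, treated as independent of $u$ when partial and variational derivatives are computed. Total differentiations are $$D_i=\frac{\partial}{\partial x^i}+u^\alpha_i\frac{\partial}{\partial u^\alpha}+v^{\bar\alpha}_i\frac{\partial}{\partial v^{\bar\alpha}}+u^\alpha_{ij}\frac{\partial}{\partial u^\alpha_j}+v^{\bar\alpha}_{ij}\frac{\partial}{\partial v^{\bar\alpha}_j}+\cdots,$$ and the Euler–Lagrange operators are $$\frac{\delta}{\delta u^\alpha}=\frac{\partial}{\partial u^\alpha}+\sum_{r\ge1}(-1)^rD_{i_1}\cdots D_{i_r}\frac{\partial}{\partial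 u^\alpha_{i_1\cdots i_r}}.$$ Symmetric form: a mixed derivative such as $u_{xy}$ is written as $\tfrac12u_{xy}+\tfrac12u_{yx}$ (similarly for higher orders), and $u_{xy},u_{yx}$ are treated as distinct variables when differentiating $\mathcal L$, so that sums over all ordered index tuples make sense. $X$ is a symmetry of (S) if $X(F_{\bar\alpha})=0$ on all solutions of (S) (i.e. modulo (S) and its differential consequences), where $X$ is prolonged to derivatives by $\zeta^\alpha_i=D_i(W^\alpha)+\xi^ju^\alpha_{ij}$, $\zeta^\alpha_{i_1i_2}=D_{i_1}D_{i_2}(W^\alpha)+\xi^ju^\alpha_{ji_1i_2}$, etc. It is a Lie point symmetry if $\xi^i,\eta^\alpha$ depend on $x,u$ only, and a Lie–Bäcklund symmetry if they are arbitrary differential functions. A nonlocal symmetry is one whose coefficients $\xi^i,\eta^\alpha$ also depend on nonlocal variables, i.e. additional variables $\sigma$ defined by a system giving all their first derivatives $\sigma_{x^i}$ in terms of $x$, $u$, derivatives of $u$ and the nonlocal variables, compatible on solutions of (S); in all total differentiations (including the prolongation formulae) the derivatives of $\sigma$ are replaced using this system. The subscript $[\ \cdot\ ]_{(S)}$ means restriction to solutions of (S). The vector $C=(C^1,\ldots,C^n)$ is not claimed to be non-trivial. *)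

theory Defs
  imports
    "HOL-Analysis.Analysis"
    "HOL-Library.Groups_Big_Fun"
    "HOL-Combinatorics.Multiset_Permutations"
begin

text \<open>
  Jet coordinates: \<open>Indep i\<close> is \<open>x\<^sup>i\<close>, \<open>Dep \<alpha> J\<close> is the derivative \<open>u\<^sup>\<alpha>\<^sub>J\<close>, and \<open>Nonloc a\<close> is a
  nonlocal variable \<open>\<sigma>\<^sup>a\<close> (its derivatives are never coordinates).  The index \<open>J\<close> is a multiset of
  independent variables, so that \<open>u\<^sub>x\<^sub>y\<close> and \<open>u\<^sub>y\<^sub>x\<close> are the same coordinate; the variant where \<open>J\<close> is
  a list, with \<open>u\<^sub>x\<^sub>y\<close> and \<open>u\<^sub>y\<^sub>x\<close> distinct, serves for symmetric forms only.
\<close>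

datatype ('n, 'd, 'j, 'k) jet_var = Indep 'n | Dep 'd 'j | Nonloc 'k

type_synonym ('n, 'd, 'k) jet = "('n, 'd, 'n multiset, 'k) jet_var \<Rightarrow> real"

type_synonym ('n, 'd, 'k) ordered_jet = "('n, 'd, 'n list, 'k) jet_var \<Rightarrow> real"

text \<open>
  Neighbourhoods below are those of the product topology, which restrict finitely many coordinates.
  The monomials in the variables \<open>V\<close> are indexed by the multisets over \<open>V\<close>.
\<close>

definition locally_analytic_in :: "'v set \<Rightarrow> ('v \<Rightarrow> real) set \<Rightarrow> (('v \<Rightarrow> real) \<Rightarrow> real) \<Rightarrow> bool" where
  "locally_analytic_in V \<Omega> f \<longleftrightarrow>
     finite V \<and>
     (\<forall>y\<in>\<Omega>. \<forall>z\<in>\<Omega>. (\<forall>v\<in>V. y v = z v) \<longrightarrow> f y = f z) \<and>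
     (\<forall>p\<in>\<Omega>. \<exists>c. \<forall>\<^sub>F z in nhds p.
        ((\<lambda>k. c k * (\<Prod>v\<in>#k. z v - p v)) has_sum f z) {k. set_mset k \<subseteq> V})"

definition jet_vars :: "nat \<Rightarrow> ('n, 'd, 'n multiset, 'k) jet_var set" where
  "jet_vars r = range Indep \<union> {Dep d J |d J. size J \<le> r}"

definition partial :: "'v \<Rightarrow> (('v \<Rightarrow> real) \<Rightarrow> real) \<Rightarrow> ('v \<Rightarrow> real) \<Rightarrow> real" where
  "partial v f z = deriv (\<lambda>t. f (z(v := t))) (z v)"

text \<open>
  In the symmetric form of \<open>f\<close> every \<open>u\<^sub>J\<close> is replaced by the mean of the variables \<open>u\<^sub>l\<close> over all
  orderings \<open>l\<close> of \<open>J\<close>.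
\<close>

definition symmetrize :: "('n, 'd, 'k) ordered_jet \<Rightarrow> ('n, 'd, 'k) jet" where
  "symmetrize w = (\<lambda>v. case v of
       Indep i \<Rightarrow> w (Indep i)
     | Dep d J \<Rightarrow> (\<Sum>l\<in>permutations_of_multiset J. w (Dep d l)) / real (card (permutations_of_multiset J))
     | Nonloc a \<Rightarrow> w (Nonloc a))"

definition ordered :: "('n, 'd, 'k) jet \<Rightarrow> ('n, 'd, 'k) ordered_jet" where
  "ordered z = (\<lambda>v. case v of
       Indep i \<Rightarrow> z (Indep i)
     | Dep d l \<Rightarrow> z (Dep d (mset l))
     | Nonloc a \<Rightarrow> z (Nonloc a))"

definition symmetric_form ::
  "(('n, 'd, 'k) jet \<Rightarrow> real) \<Rightarrow> ('n, 'd, 'k) ordered_jet \<Rightarrow> real" where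
  "symmetric_form f w = f (symmetrize w)"

text \<open>\<open>dpartial d [i\<^sub>1, \<dots>, i\<^sub>r] f\<close> is \<open>\<partial>f/\<partial>u\<^sup>d\<^sub>i\<^sub>1\<^sub>\<dots>\<^sub>i\<^sub>r\<close> for \<open>f\<close> written in symmetric form.\<close>

definition dpartial ::
  "'d \<Rightarrow> 'n list \<Rightarrow> (('n, 'd, 'k) jet \<Rightarrow> real) \<Rightarrow> ('n, 'd, 'k) jet \<Rightarrow> real" where
  "dpartial d l f z = partial (Dep d l) (symmetric_form f) (ordered z)"

text \<open>
  Total differentiation in the presence of nonlocal variables \<open>\<sigma>\<^sup>a\<close>, \<open>a \<in> K\<close>, with defining system
  \<open>\<sigma>\<^sup>a\<^sub>i = G a i\<close>.  The sums over all index tuples are finite for differential functions.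
\<close>

definition total_diff ::
  "'k set \<Rightarrow> ('k \<Rightarrow> 'n \<Rightarrow> ('n, 'd::finite, 'k) jet \<Rightarrow> real) \<Rightarrow> 'n
    \<Rightarrow> (('n, 'd, 'k) jet \<Rightarrow> real) \<Rightarrow> ('n, 'd, 'k) jet \<Rightarrow> real" where
  "total_diff K G i f z =
     partial (Indep i) f z
     + (\<Sum>d\<in>UNIV. Sum_any (\<lambda>l. z (Dep d (mset (i # l))) * dpartial d l f z))
     + (\<Sum>a\<in>K. G a i z * partial (Nonloc a) f z)"

abbreviation total_diffs ::
  "'k set \<Rightarrow> ('k \<Rightarrow> 'n \<Rightarrow> ('n, 'd::finite, 'k) jet \<Rightarrow> real) \<Rightarrow> 'n list
    \<Rightarrow> (('n, 'd, 'k) jet \<Rightarrow> real) \<Rightarrow> ('n, 'd, 'k) jet \<Rightarrow> real" where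
  "total_diffs K G l f \<equiv> foldr (total_diff K G) l f"

abbreviation no_system :: "'k \<Rightarrow> 'n \<Rightarrow> ('n, 'd, 'k) jet \<Rightarrow> real" where
  "no_system \<equiv> \<lambda>_ _ _. 0"

definition euler_lagrange ::
  "'d::finite \<Rightarrow> (('n, 'd, 'k) jet \<Rightarrow> real) \<Rightarrow> ('n, 'd, 'k) jet \<Rightarrow> real" where
  "euler_lagrange d f z =
     Sum_any (\<lambda>l. (-1) ^ length l * total_diffs {} no_system l (dpartial d l f) z)"

text \<open>The jets annihilated by the system and all its differential consequences.\<close>

definition solution_set ::
  "('n, 'm::finite, 'k) jet set \<Rightarrow> ('b \<Rightarrow> ('n, 'm, 'k) jet \<Rightarrow> real) \<Rightarrow> ('n, 'm, 'k) jet set" where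
  "solution_set \<Omega> F = {z \<in> \<Omega>. \<forall>b l. total_diffs {} no_system l (F b) z = 0}"

text \<open>
  With the auxiliary variables adjoined, the dependent variables are \<open>Inl \<alpha>\<close> for \<open>u\<^sup>\<alpha>\<close> and \<open>Inr b\<close>
  for \<open>v\<^sup>b\<close>.
\<close>

definition forget_v :: "('n, 'm + 'b, 'k) jet \<Rightarrow> ('n, 'm, 'k) jet" where
  "forget_v z = (\<lambda>v. case v of
       Indep i \<Rightarrow> z (Indep i)
     | Dep \<alpha> J \<Rightarrow> z (Dep (Inl \<alpha>) J)
     | Nonloc a \<Rightarrow> z (Nonloc a))"

text \<open>
  Substitution of \<open>\<phi>\<close> for \<open>v\<close> and of the total derivatives of \<open>\<phi>\<close> for those of \<open>v\<close>.  The choice of the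
  ordering of \<open>J\<close> is immaterial, since local total differentiations of analytic functions commute.
\<close>

definition substitute_v ::
  "('b \<Rightarrow> ('n, 'm::finite, 'k) jet \<Rightarrow> real) \<Rightarrow> ('n, 'm, 'k) jet \<Rightarrow> ('n, 'm + 'b, 'k) jet" where
  "substitute_v \<phi> z = (\<lambda>v. case v of
       Indep i \<Rightarrow> z (Indep i)
     | Dep d J \<Rightarrow> (case d of
           Inl \<alpha> \<Rightarrow> z (Dep \<alpha> J)
         | Inr b \<Rightarrow> total_diffs {} no_system (SOME l. mset l = J) (\<phi> b) z)
     | Nonloc a \<Rightarrow> z (Nonloc a))"

definition formal_lagrangian ::
  "('b::finite \<Rightarrow> ('n, 'm, 'k) jet \<Rightarrow> real) \<Rightarrow> ('n, 'm + 'b, 'k) jet \<Rightarrow> real" where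
  "formal_lagrangian F z = (\<Sum>b\<in>UNIV. z (Dep (Inr b) {#}) * F b (forget_v z))"

definition nonlinearly_self_adjoint ::
  "('n, 'm::finite, 'k) jet set \<Rightarrow> ('b::finite \<Rightarrow> ('n, 'm, 'k) jet \<Rightarrow> real)
    \<Rightarrow> ('b \<Rightarrow> ('n, 'm, 'k) jet \<Rightarrow> real) \<Rightarrow> bool" where
  "nonlinearly_self_adjoint \<Omega> F \<phi> \<longleftrightarrow>
     (\<forall>b. locally_analytic_in (jet_vars 0) \<Omega> (\<phi> b)) \<and>
     (\<exists>b. \<exists>z\<in>\<Omega>. \<phi> b z \<noteq> 0) \<and>
     (\<forall>\<alpha>. \<forall>z\<in>solution_set \<Omega> F.
        euler_lagrange (Inl \<alpha>) (formal_lagrangian F) (substitute_v \<phi> z) = 0)"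

definition characteristic ::
  "('n::finite \<Rightarrow> ('n, 'm, 'k) jet \<Rightarrow> real) \<Rightarrow> ('m \<Rightarrow> ('n, 'm, 'k) jet \<Rightarrow> real)
    \<Rightarrow> 'm \<Rightarrow> ('n, 'm, 'k) jet \<Rightarrow> real" where
  "characteristic \<xi> \<eta> \<alpha> z = \<eta> \<alpha> z - (\<Sum>j\<in>UNIV. \<xi> j z * z (Dep \<alpha> {#j#}))"

definition prolong_coeff ::
  "'k set \<Rightarrow> ('k \<Rightarrow> 'n \<Rightarrow> ('n, 'm, 'k) jet \<Rightarrow> real)
    \<Rightarrow> ('n::finite \<Rightarrow> ('n, 'm::finite, 'k) jet \<Rightarrow> real) \<Rightarrow> ('m \<Rightarrow> ('n, 'm, 'k) jet \<Rightarrow> real)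
    \<Rightarrow> 'm \<Rightarrow> 'n list \<Rightarrow> ('n, 'm, 'k) jet \<Rightarrow> real" where
  "prolong_coeff K G \<xi> \<eta> \<alpha> l z =
     (if l = [] then \<eta> \<alpha> z
      else total_diffs K G l (characteristic \<xi> \<eta> \<alpha>) z
           + (\<Sum>j\<in>UNIV. \<xi> j z * z (Dep \<alpha> (mset (j # l)))))"

definition prolonged_field ::
  "'k set \<Rightarrow> ('k \<Rightarrow> 'n \<Rightarrow> ('n, 'm, 'k) jet \<Rightarrow> real)
    \<Rightarrow> ('n::finite \<Rightarrow> ('n, 'm::finite, 'k) jet \<Rightarrow> real) \<Rightarrow> ('m \<Rightarrow> ('n, 'm, 'k) jet \<Rightarrow> real)
    \<Rightarrow> (('n, 'm, 'k) jet \<Rightarrow> real) \<Rightarrow> ('n, 'm, 'k) jet \<Rightarrow> real" where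
  "prolonged_field K G \<xi> \<eta> f z =
     (\<Sum>i\<in>UNIV. \<xi> i z * partial (Indep i) f z)
     + (\<Sum>\<alpha>\<in>UNIV. Sum_any (\<lambda>l. prolong_coeff K G \<xi> \<eta> \<alpha> l z * dpartial \<alpha> l f z))"

definition leaves_invariant ::
  "('n::finite, 'm::finite, 'k) jet set \<Rightarrow> ('b \<Rightarrow> ('n, 'm, 'k) jet \<Rightarrow> real)
    \<Rightarrow> 'k set \<Rightarrow> ('k \<Rightarrow> 'n \<Rightarrow> ('n, 'm, 'k) jet \<Rightarrow> real)
    \<Rightarrow> ('n \<Rightarrow> ('n, 'm, 'k) jet \<Rightarrow> real) \<Rightarrow> ('m \<Rightarrow> ('n, 'm, 'k) jet \<Rightarrow> real) \<Rightarrow> bool" where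
  "leaves_invariant \<Omega> F K G \<xi> \<eta> \<longleftrightarrow>
     (\<forall>b. \<forall>z\<in>solution_set \<Omega> F. prolonged_field K G \<xi> \<eta> (F b) z = 0)"

definition lie_point_symmetry ::
  "('n::finite, 'm::finite, 'k) jet set \<Rightarrow> ('b \<Rightarrow> ('n, 'm, 'k) jet \<Rightarrow> real)
    \<Rightarrow> ('n \<Rightarrow> ('n, 'm, 'k) jet \<Rightarrow> real) \<Rightarrow> ('m \<Rightarrow> ('n, 'm, 'k) jet \<Rightarrow> real) \<Rightarrow> bool" where
  "lie_point_symmetry \<Omega> F \<xi> \<eta> \<longleftrightarrow>
     (\<forall>i. locally_analytic_in (jet_vars 0) \<Omega> (\<xi> i)) \<and>
     (\<forall>\<alpha>. locally_analytic_in (jet_vars 0) \<Omega> (\<eta> \<alpha>)) \<and>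
     leaves_invariant \<Omega> F {} no_system \<xi> \<eta>"

text \<open>A contact field has first-order coefficients, and so has its prolongation to first derivatives.\<close>

definition contact_symmetry ::
  "('n::finite, 'm::finite, 'k) jet set \<Rightarrow> ('b \<Rightarrow> ('n, 'm, 'k) jet \<Rightarrow> real)
    \<Rightarrow> ('n \<Rightarrow> ('n, 'm, 'k) jet \<Rightarrow> real) \<Rightarrow> ('m \<Rightarrow> ('n, 'm, 'k) jet \<Rightarrow> real) \<Rightarrow> bool" where
  "contact_symmetry \<Omega> F \<xi> \<eta> \<longleftrightarrow>
     (\<forall>i. locally_analytic_in (jet_vars 1) \<Omega> (\<xi> i)) \<and>
     (\<forall>\<alpha>. locally_analytic_in (jet_vars 1) \<Omega> (\<eta> \<alpha>)) \<and>
     (\<forall>\<alpha> i. locally_analytic_in (jet_vars 1) \<Omega> (prolong_coeff {} no_system \<xi> \<eta> \<alpha> [i])) \<and>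
     leaves_invariant \<Omega> F {} no_system \<xi> \<eta>"

definition lie_baecklund_symmetry ::
  "('n::finite, 'm::finite, 'k) jet set \<Rightarrow> ('b \<Rightarrow> ('n, 'm, 'k) jet \<Rightarrow> real)
    \<Rightarrow> ('n \<Rightarrow> ('n, 'm, 'k) jet \<Rightarrow> real) \<Rightarrow> ('m \<Rightarrow> ('n, 'm, 'k) jet \<Rightarrow> real) \<Rightarrow> bool" where
  "lie_baecklund_symmetry \<Omega> F \<xi> \<eta> \<longleftrightarrow>
     (\<forall>i. \<exists>r. locally_analytic_in (jet_vars r) \<Omega> (\<xi> i)) \<and>
     (\<forall>\<alpha>. \<exists>r. locally_analytic_in (jet_vars r) \<Omega> (\<eta> \<alpha>)) \<and>
     leaves_invariant \<Omega> F {} no_system \<xi> \<eta>"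

definition nonlocal_function ::
  "'k set \<Rightarrow> ('n, 'm, 'k) jet set \<Rightarrow> (('n, 'm, 'k) jet \<Rightarrow> real) \<Rightarrow> bool" where
  "nonlocal_function K \<Omega> f \<longleftrightarrow> (\<exists>r. locally_analytic_in (jet_vars r \<union> Nonloc ` K) \<Omega> f)"

definition nonlocal_system ::
  "('n, 'm::finite, 'k) jet set \<Rightarrow> ('b \<Rightarrow> ('n, 'm, 'k) jet \<Rightarrow> real)
    \<Rightarrow> 'k set \<Rightarrow> ('k \<Rightarrow> 'n \<Rightarrow> ('n, 'm, 'k) jet \<Rightarrow> real) \<Rightarrow> bool" where
  "nonlocal_system \<Omega> F K G \<longleftrightarrow>
     finite K \<and>
     (\<forall>a\<in>K. \<forall>i. nonlocal_function K \<Omega> (G a i)) \<and>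
     (\<forall>a\<in>K. \<forall>i j. \<forall>z\<in>solution_set \<Omega> F. total_diff K G i (G a j) z = total_diff K G j (G a i) z)"

definition nonlocal_symmetry ::
  "('n::finite, 'm::finite, 'k) jet set \<Rightarrow> ('b \<Rightarrow> ('n, 'm, 'k) jet \<Rightarrow> real)
    \<Rightarrow> 'k set \<Rightarrow> ('k \<Rightarrow> 'n \<Rightarrow> ('n, 'm, 'k) jet \<Rightarrow> real)
    \<Rightarrow> ('n \<Rightarrow> ('n, 'm, 'k) jet \<Rightarrow> real) \<Rightarrow> ('m \<Rightarrow> ('n, 'm, 'k) jet \<Rightarrow> real) \<Rightarrow> bool" where
  "nonlocal_symmetry \<Omega> F K G \<xi> \<eta> \<longleftrightarrow>
     nonlocal_system \<Omega> F K G \<and>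
     (\<forall>i. nonlocal_function K \<Omega> (\<xi> i)) \<and>
     (\<forall>\<alpha>. nonlocal_function K \<Omega> (\<eta> \<alpha>)) \<and>
     leaves_invariant \<Omega> F K G \<xi> \<eta>"

text \<open>
  The vector \<open>C\<close> before elimination of \<open>v\<close>: for each index tuple \<open>l\<close>, the derivative \<open>D\<^sub>l(W\<^sup>\<alpha>)\<close> is
  multiplied by the alternating sum over all \<open>k\<close> of \<open>D\<^sub>k(\<partial>\<L>/\<partial>u\<^sup>\<alpha>\<^sub>i\<^sub>l\<^sub>k)\<close>.
\<close>

definition conserved_vector_v ::
  "('b::finite \<Rightarrow> ('n, 'm::finite, 'k) jet \<Rightarrow> real)
    \<Rightarrow> 'k set \<Rightarrow> ('k \<Rightarrow> 'n \<Rightarrow> ('n, 'm, 'k) jet \<Rightarrow> real)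
    \<Rightarrow> ('n::finite \<Rightarrow> ('n, 'm, 'k) jet \<Rightarrow> real) \<Rightarrow> ('m \<Rightarrow> ('n, 'm, 'k) jet \<Rightarrow> real)
    \<Rightarrow> 'n \<Rightarrow> ('n, 'm + 'b, 'k) jet \<Rightarrow> real" where
  "conserved_vector_v F K G \<xi> \<eta> i z =
     (let L = formal_lagrangian F;
          D = total_diffs K (\<lambda>a j. G a j \<circ> forget_v);
          W = (\<lambda>\<alpha>. characteristic \<xi> \<eta> \<alpha> \<circ> forget_v)
      in \<xi> i (forget_v z) * L z
         + (\<Sum>\<alpha>\<in>UNIV. Sum_any (\<lambda>l. D l (W \<alpha>) z *
              Sum_any (\<lambda>k. (-1) ^ length k * D k (dpartial (Inl \<alpha>) (i # l @ k) L) z))))"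

definition conserved_vector ::
  "('b::finite \<Rightarrow> ('n, 'm::finite, 'k) jet \<Rightarrow> real) \<Rightarrow> ('b \<Rightarrow> ('n, 'm, 'k) jet \<Rightarrow> real)
    \<Rightarrow> 'k set \<Rightarrow> ('k \<Rightarrow> 'n \<Rightarrow> ('n, 'm, 'k) jet \<Rightarrow> real)
    \<Rightarrow> ('n::finite \<Rightarrow> ('n, 'm, 'k) jet \<Rightarrow> real) \<Rightarrow> ('m \<Rightarrow> ('n, 'm, 'k) jet \<Rightarrow> real)
    \<Rightarrow> 'n \<Rightarrow> ('n, 'm, 'k) jet \<Rightarrow> real" where
  "conserved_vector F \<phi> K G \<xi> \<eta> i z = conserved_vector_v F K G \<xi> \<eta> i (substitute_v \<phi> z)"

definition conservation_law ::
  "('n::finite, 'm::finite, 'k) jet set \<Rightarrow> ('b \<Rightarrow> ('n, 'm, 'k) jet \<Rightarrow> real)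
    \<Rightarrow> 'k set \<Rightarrow> ('k \<Rightarrow> 'n \<Rightarrow> ('n, 'm, 'k) jet \<Rightarrow> real)
    \<Rightarrow> ('n \<Rightarrow> ('n, 'm, 'k) jet \<Rightarrow> real) \<Rightarrow> bool" where
  "conservation_law \<Omega> F K G C \<longleftrightarrow>
     (\<forall>z\<in>solution_set \<Omega> F. (\<Sum>i\<in>UNIV. total_diff K G i (C i) z) = 0)"

end

theory Submission
  imports Defs
begin

text \<open>
  For \<open>E\<^sub>l = \<Sum>\<^sub>k (-1)\<^sup>|\<^sup>k\<^sup>| D\<^sub>k(\<partial>\<L>/\<partial>u\<^sub>l\<^sub>k)\<close> one has \<open>D\<^sub>i(E\<^sub>i\<^sub>l) = \<partial>\<L>/\<partial>u\<^sub>l - E\<^sub>l\<close> (sum over \<open>i\<close>), so in the divergence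
  of \<open>D\<^sub>l(W) E\<^sub>i\<^sub>l\<close> everything telescopes except \<open>D\<^sub>l(W) \<partial>\<L>/\<partial>u\<^sub>l - W \<delta>\<L>/\<delta>u\<close>.  On solutions the first term vanishes
  by invariance, since there \<open>X(F) = D\<^sub>l(W) \<partial>F/\<partial>u\<^sub>l\<close>, and the second by self-adjointness.  No two total
  differentiations of \<open>W\<close> are ever interchanged; this matters in the nonlocal case, where they commute
  on solutions only.
\<close>

section \<open>Termwise differentiation of power series in several variables\<close>

text \<open>The solution set is not open, so an identity that holds only on it says nothing about
  total derivatives. Hence every identity that gets differentiated is proved on all of the open set
  \<open>\<Omega>\<close>, while self-adjointness and invariance enter only at the single point
  where the divergence is evaluated. There L = \<phi>^b F_b vanishes together with its first total
  derivatives, because \<open>solution_set\<close> includes the differential consequences; this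
  disposes of the term \<xi>^i L. For the same reason the first sum in X(F) = \<xi>^i D_i(F) +
  D_l(W) dF/du_l vanishes. The auxiliary variables are eliminated before the divergence is taken.
  This requires that substituting \<phi> for v commute with total differentiation, and it is here
  that local total differentiations have to commute with each other: v_J is replaced by D_J(\<phi>)
  for one chosen ordering of J. Since F and \<phi> do not involve \<sigma>, the local
  differentiations in the self-adjointness hypothesis agree on them with those that the system for
  \<sigma> defines.\<close>

text \<open>Joint continuity of \<open>z(v := t)\<close> in \<open>z\<close> and \<open>t\<close>
  yields a box around \<open>(p, p v)\<close>. One \<open>e\<close> serves all nearby
  \<open>z\<close>, so a series valid near \<open>p\<close> becomes, through every such
  \<open>z\<close>, a one-variable series on a fixed interval.\<close>

lemma eventually_nhds_fun_upd:
  fixes p :: "'v \<Rightarrow> real"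
  assumes "eventually P (nhds p)"
  shows "\<exists>e>0. \<forall>\<^sub>F z in nhds p. \<forall>t. \<bar>t - p v\<bar> < e \<longrightarrow> P (z(v := t))"
proof -
  let ?upd = "\<lambda>x :: ('v \<Rightarrow> real) \<times> real. (fst x)(v := snd x)"
  have cont: "continuous_on UNIV ?upd"
  proof (rule continuous_on_coordinatewise_then_product)
    fix w :: 'v
    have "continuous_on UNIV (\<lambda>x :: ('v \<Rightarrow> real) \<times> real. fst x w)"
      by (rule continuous_on_product_then_coordinatewise[OF continuous_on_fst[OF continuous_on_id]])
    moreover have "continuous_on UNIV (\<lambda>x :: ('v \<Rightarrow> real) \<times> real. snd x)"
      by (rule continuous_on_snd[OF continuous_on_id])
    ultimately show "continuous_on UNIV (\<lambda>x. ?upd x w)"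
      by (cases "w = v") simp_all
  qed
  obtain U where U: "open U" "p \<in> U" "\<forall>z\<in>U. P z"
    using assms unfolding eventually_nhds by blast
  have "open (?upd -` U)"
    using open_vimage[OF U(1) cont] .
  moreover have "(p, p v) \<in> ?upd -` U"
    using U(2) by simp
  ultimately obtain A B where AB: "open A" "open B" "(p, p v) \<in> A \<times> B" "A \<times> B \<subseteq> ?upd -` U"
    by (rule open_prod_elim)
  then have in_AB: "p \<in> A" "p v \<in> B" by simp_all
  obtain e where e: "e > 0" "ball (p v) e \<subseteq> B"
    using openE[OF AB(2) in_AB(2)] .
  have "P (z(v := t))" if "z \<in> A" "\<bar>t - p v\<bar> < e" for z t
  proof -
    have "t \<in> ball (p v) e"
      using that(2) by (simp add: dist_real_def abs_minus_commute)
    then have "(z, t) \<in> ?upd -` U"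
      using AB(4) e(2) that(1) by blast
    then show ?thesis using U(3) by simp
  qed
  then have "\<forall>\<^sub>F z in nhds p. \<forall>t. \<bar>t - p v\<bar> < e \<longrightarrow> P (z(v := t))"
    using eventually_nhds_in_open[OF AB(1) in_AB(1)] by (simp add: eventually_mono)
  with e(1) show ?thesis by blast
qed

lemma eventually_fun_upd_in_open:
  fixes z :: "'v \<Rightarrow> real"
  assumes "open \<Omega>" "z \<in> \<Omega>"
  shows "\<forall>\<^sub>F t in nhds (z v). z(v := t) \<in> \<Omega>"
proof -
  from eventually_nhds_fun_upd[OF eventually_nhds_in_open[OF assms], of v]
  obtain e where "e > 0" "\<forall>\<^sub>F y in nhds z. \<forall>t. \<bar>t - z v\<bar> < e \<longrightarrow> y(v := t) \<in> \<Omega>"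
    by blast
  then have "e > 0" "\<forall>t. \<bar>t - z v\<bar> < e \<longrightarrow> z(v := t) \<in> \<Omega>"
    using eventually_nhds_x_imp_x by fast+
  then show ?thesis
    unfolding eventually_nhds_metric dist_real_def by blast
qed

section \<open>One-variable power series with terms indexed by an arbitrary set\<close>

text \<open>The graph of the convex function t^n lies above its tangent at x, here evaluated at r.
  For x < r this gives n x^(n-1) \<le> r^n / (r - x), which dominates the termwise derivative at x
  by the series at the larger radius r.\<close>

lemma nat_mult_power_le:
  fixes x r :: real
  assumes "0 \<le> x" "x \<le> r"
  shows "real n * x ^ (n - 1) * (r - x) \<le> r ^ n - x ^ n"
proof (induction n)
  case (Suc n)
  have "x * (real n * x ^ (n - 1)) = real n * x ^ n"
    by (cases n) auto
  moreover have "real (Suc n) * x ^ n * (r - x) = real n * x ^ n * (r - x) + x ^ n * (r - x)"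
    by (simp add: algebra_simps)
  ultimately have "real (Suc n) * x ^ n * (r - x) = x * (real n * x ^ (n - 1) * (r - x)) + x ^ n * (r - x)"
    by (metis mult.assoc)
  also have "\<dots> \<le> x * (r ^ n - x ^ n) + x ^ n * (r - x)"
    using Suc assms by (simp add: mult_left_mono)
  also have "\<dots> = r ^ Suc n - x ^ Suc n - (r - x) * (r ^ n - x ^ n)"
    by (simp add: algebra_simps)
  also have "\<dots> \<le> r ^ Suc n - x ^ Suc n"
    using assms by (simp add: power_mono)
  finally show ?case by simp
qed simp

text \<open>The fibres of \<open>n\<close> partition \<open>I\<close>, and an unconditional sum may
  be computed fibre by fibre. This collects the terms of a multivariate series that share an
  exponent.\<close>

lemma has_sum_group:
  fixes f :: "'i \<Rightarrow> real"
  assumes "(f has_sum s) I"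
  shows "((\<lambda>j. \<Sum>\<^sub>\<infinity>k\<in>{k\<in>I. n k = j}. f k) has_sum s) (UNIV :: nat set)"
proof -
  let ?A = "\<lambda>j. {k\<in>I. n k = j}"
  have img: "(\<lambda>k. (n k, k)) ` I = Sigma UNIV ?A" by auto
  have "((f \<circ> snd) has_sum s) ((\<lambda>k. (n k, k)) ` I)"
    by (subst has_sum_reindex) (use assms in \<open>auto simp: inj_on_def o_def\<close>)
  then have S: "((f \<circ> snd) has_sum s) (Sigma UNIV ?A)"
    unfolding img .
  have "(f has_sum (\<Sum>\<^sub>\<infinity>k\<in>?A j. f k)) (?A j)" for j
    by (intro has_sum_infsum summable_on_subset_banach[OF has_sum_imp_summable[OF assms]]) blast
  then show ?thesis
    using has_sum_Sigma'[OF S, of "\<lambda>j. \<Sum>\<^sub>\<infinity>k\<in>?A j. f k"] by simp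
qed

text \<open>Infinitely many \<open>k\<close> may share the exponent \<open>n k\<close>. Grouping
  them gives an ordinary power series with coefficients \<open>a j\<close>, which
  \<open>termdiffs_strong\<close> differentiates. The ungrouped derivative converges absolutely by
  comparison with the series at radius \<open>r\<close>, and grouping it returns the same
  value.\<close>

lemma has_sum_power_derivative:
  fixes b :: "'i \<Rightarrow> real" and n :: "'i \<Rightarrow> nat"
  assumes sum: "\<And>y. \<bar>y\<bar> < e \<Longrightarrow> ((\<lambda>k. b k * y ^ n k) has_sum g y) I" and x: "\<bar>x\<bar> < e"
  obtains D where "(g has_field_derivative D) (at x)"
    "((\<lambda>k. b k * (real (n k) * x ^ (n k - 1))) has_sum D) I"
proof -
  obtain r where r: "\<bar>x\<bar> < r" "r < e"
    using x dense by blast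
  define a where "a j = (\<Sum>\<^sub>\<infinity>k\<in>{k\<in>I. n k = j}. b k)" for j
  have group: "(\<Sum>\<^sub>\<infinity>k\<in>{k\<in>I. n k = j}. b k * h (n k)) = a j * h j" for j and h :: "nat \<Rightarrow> real"
  proof -
    have "(\<Sum>\<^sub>\<infinity>k\<in>{k\<in>I. n k = j}. b k * h (n k)) = (\<Sum>\<^sub>\<infinity>k\<in>{k\<in>I. n k = j}. b k * h j)"
      by (rule infsum_cong) auto
    then show ?thesis
      by (simp add: a_def infsum_cmult_left')
  qed
  have g: "(\<lambda>j. a j * y ^ j) sums g y" if "\<bar>y\<bar> < e" for y
    using has_sum_group[OF sum[OF that], of n] unfolding group[of "\<lambda>j. y ^ j"]
    by (rule has_sum_imp_sums)
  have "((\<lambda>y. suminf (\<lambda>j. a j * y ^ j)) has_field_derivative suminf (\<lambda>j. diffs a j * x ^ j)) (at x)"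
    using g[of r] r by (intro termdiffs_strong[of _ r]) (auto simp: summable_def)
  moreover have "\<forall>\<^sub>F y in nhds x. suminf (\<lambda>j. a j * y ^ j) = g y"
    unfolding eventually_nhds_metric
  proof (intro exI[of _ "e - \<bar>x\<bar>"] conjI allI impI)
    fix y assume "dist y x < e - \<bar>x\<bar>"
    then have "\<bar>y\<bar> < e" by (auto simp: dist_real_def)
    then show "suminf (\<lambda>j. a j * y ^ j) = g y" using g sums_unique by metis
  qed (use x in auto)
  ultimately have deriv: "(g has_field_derivative suminf (\<lambda>j. diffs a j * x ^ j)) (at x)"
    using DERIV_cong_ev[OF refl _ refl, of "\<lambda>y. suminf (\<lambda>j. a j * y ^ j)" g] by simp
  have "(\<lambda>k. b k * r ^ n k) summable_on I"
    using sum[of r] r by (auto simp: summable_on_def)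
  then have "(\<lambda>k. norm (b k * r ^ n k) * (1 / (r - \<bar>x\<bar>))) summable_on I"
    by (intro summable_on_cmult_left) (rule summable_on_iff_abs_summable_on_real[THEN iffD1])
  then have "(\<lambda>k. norm (b k * (real (n k) * x ^ (n k - 1)))) summable_on I"
  proof (rule Infinite_Sum.abs_summable_on_comparison_test')
    fix k
    have "real (n k) * \<bar>x\<bar> ^ (n k - 1) * (r - \<bar>x\<bar>) \<le> r ^ n k - \<bar>x\<bar> ^ n k"
      by (rule nat_mult_power_le) (use r in auto)
    also have "\<dots> \<le> r ^ n k" by simp
    finally have "real (n k) * \<bar>x\<bar> ^ (n k - 1) \<le> r ^ n k / (r - \<bar>x\<bar>)"
      using r by (simp add: field_simps)
    from mult_left_mono[OF this, of "\<bar>b k\<bar>"]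
    show "norm (b k * (real (n k) * x ^ (n k - 1))) \<le> norm (b k * r ^ n k) * (1 / (r - \<bar>x\<bar>))"
      using r by (simp add: abs_mult power_abs)
  qed
  from summable_on_iff_abs_summable_on_real[THEN iffD2, OF this]
  obtain D where D: "((\<lambda>k. b k * (real (n k) * x ^ (n k - 1))) has_sum D) I"
    by (auto simp: summable_on_def)
  from has_sum_group[OF this, of n]
  have "(\<lambda>j. a j * (real j * x ^ (j - 1))) sums D"
    unfolding group[of "\<lambda>j. real j * x ^ (j - 1)"] by (rule has_sum_imp_sums)
  moreover have "summable (\<lambda>j. a j * y ^ j)" if "norm y < r" for y
    using g[of y] that r by (auto simp: summable_def)
  then have "summable (\<lambda>j. diffs a j * x ^ j)"
    using r by (intro termdiff_converges[of x r a]) auto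
  ultimately have "D = suminf (\<lambda>j. diffs a j * x ^ j)"
    using diffs_equiv[of a x] sums_unique2 by (fastforce simp: mult_ac)
  with deriv D that show thesis by blast
qed

lemma prod_mset_remove_var:
  fixes g :: "'v \<Rightarrow> real"
  shows "(\<Prod>w\<in>#k. g w) = (\<Prod>w\<in># filter_mset (\<lambda>w. w \<noteq> v) k. g w) * g v ^ count k v"
  by (induction k) auto

text \<open>Along the \<open>v\<close>-line through \<open>z\<close> the other coordinates are
  frozen, and the series becomes one in \<open>t - p v\<close> with exponents
  \<open>count k v\<close>. Differentiability is part of the conclusion because
  \<open>partial\<close> is a \<open>deriv\<close>, whose value means nothing without it.\<close>

lemma power_series_partial:
  fixes f :: "('v \<Rightarrow> real) \<Rightarrow> real"
  assumes f: "\<forall>\<^sub>F z in nhds p. ((\<lambda>k. c k * (\<Prod>v\<in>#k. z v - p v)) has_sum f z) {k. set_mset k \<subseteq> V}"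
    and v: "v \<in> V"
  shows "\<forall>\<^sub>F z in nhds p. (\<lambda>t. f (z(v := t))) field_differentiable at (z v) \<and>
    ((\<lambda>k. (real (count k v + 1) * c (add_mset v k)) * (\<Prod>v\<in>#k. z v - p v)) has_sum partial v f z)
      {k. set_mset k \<subseteq> V}"
proof -
  from eventually_nhds_fun_upd[OF f, of v] obtain e where e: "0 < e"
    and upd: "\<forall>\<^sub>F z in nhds p. \<forall>t. \<bar>t - p v\<bar> < e \<longrightarrow>
      ((\<lambda>k. c k * (\<Prod>w\<in>#k. (z(v := t)) w - p w)) has_sum f (z(v := t))) {k. set_mset k \<subseteq> V}"
    by blast
  have "open ((\<lambda>z :: 'v \<Rightarrow> real. z v) -` ball (p v) e)"
    by (rule open_vimage[OF open_ball continuous_on_product_then_coordinatewise[OF continuous_on_id]])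
  from eventually_nhds_in_open[OF this, of p] have "\<forall>\<^sub>F z in nhds p. \<bar>z v - p v\<bar> < e"
    using e by (simp add: dist_real_def abs_minus_commute)
  with upd show ?thesis
  proof eventually_elim
    case (elim z)
    define M where "M k = (\<Prod>w\<in># filter_mset (\<lambda>w. w \<noteq> v) k. z w - p w)" for k
    have prod: "(\<Prod>w\<in>#k. (z(v := p v + y)) w - p w) = M k * y ^ count k v" for k y
      unfolding prod_mset_remove_var[of _ k v] M_def
      by (auto intro!: arg_cong[of _ _ prod_mset] image_mset_cong)
    have "((\<lambda>k. c k * M k * y ^ count k v) has_sum f (z(v := p v + y))) {k. set_mset k \<subseteq> V}"
      if "\<bar>y\<bar> < e" for y
      using elim(1)[rule_format, of "p v + y"] that unfolding prod by (simp add: mult.assoc)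
    from has_sum_power_derivative[OF this elim(2)] obtain D where
      D: "((\<lambda>y. f (z(v := p v + y))) has_field_derivative D) (at (z v - p v))"
      and sum: "((\<lambda>k. c k * M k * (real (count k v) * (z v - p v) ^ (count k v - 1))) has_sum D)
        {k. set_mset k \<subseteq> V}"
      by blast
    have "((\<lambda>t. f (z(v := p v + (t - p v)))) has_field_derivative D * 1) (at (z v))"
      by (rule DERIV_chain2[where f = "\<lambda>y. f (z(v := p v + y))" and g = "\<lambda>t. t - p v", OF D])
      (auto intro!: derivative_eq_intros)
    then have deriv: "((\<lambda>t. f (z(v := t))) has_field_derivative D) (at (z v))"
      by simp
    then have part: "partial v f z = D"
      by (simp add: partial_def DERIV_imp_deriv)
    let ?h = "\<lambda>k. c k * M k * (real (count k v) * (z v - p v) ^ (count k v - 1))"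
    \<comment> \<open>Monomials without \<open>v\<close> have derivative 0. The others are of the
      form \<open>add_mset v k\<close>, and their exponent \<open>count k v + 1\<close> becomes the
      new factor.\<close>
    have "(?h has_sum D) (add_mset v ` {k. set_mset k \<subseteq> V})"
      using sum
    proof (rule has_sum_cong_neutral[THEN iffD1, rotated -1])
      fix k assume k: "k \<in> {k. set_mset k \<subseteq> V} - add_mset v ` {k. set_mset k \<subseteq> V}"
      have "v \<notin># k"
      proof
        assume "v \<in># k"
        then obtain k' where "k = add_mset v k'" by (metis mset_add)
        with k show False by auto
      qed
      then show "?h k = 0" by (simp add: not_in_iff)
    qed (use v in auto)
    then have "((?h \<circ> add_mset v) has_sum D) {k. set_mset k \<subseteq> V}"
      by (subst (asm) has_sum_reindex) (simp_all add: inj_on_def)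
    moreover have "?h \<circ> add_mset v =
        (\<lambda>k. (real (count k v + 1) * c (add_mset v k)) * (\<Prod>v\<in>#k. z v - p v))"
      (is "_ = ?h'")
    proof
      fix k show "(?h \<circ> add_mset v) k = ?h' k"
        unfolding prod_mset_remove_var[of _ k v] by (simp add: M_def)
    qed
    ultimately show ?case
      using deriv unfolding part field_differentiable_def by (simp only:) blast
  qed
qed

lemma partial_cong_open:
  assumes "open \<Omega>" "z \<in> \<Omega>" "\<And>y. y \<in> \<Omega> \<Longrightarrow> f y = g y"
  shows "partial v f z = partial v g z"
  unfolding partial_def using eventually_fun_upd_in_open[OF assms(1,2), of v]
  by (intro deriv_cong_ev refl) (auto elim: eventually_mono intro: assms)

section \<open>Functions determined by a set of coordinates\<close>

text \<open>The dependence clause of \<open>locally_analytic_in\<close> on its own; it passes to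
  sums, products and partial derivatives with no reference to series.\<close>

definition determined_by :: "('v \<Rightarrow> real) set \<Rightarrow> 'v set \<Rightarrow> (('v \<Rightarrow> real) \<Rightarrow> real) \<Rightarrow> bool" where
  "determined_by \<Omega> W f \<longleftrightarrow> (\<forall>y\<in>\<Omega>. \<forall>z\<in>\<Omega>. (\<forall>v\<in>W. y v = z v) \<longrightarrow> f y = f z)"

lemma eventually_determined_by:
  assumes "open \<Omega>" "z \<in> \<Omega>" "determined_by \<Omega> W f" "v \<notin> W"
  shows "\<forall>\<^sub>F t in nhds (z v). f (z(v := t)) = f z"
  using eventually_fun_upd_in_open[OF assms(1,2), of v]
proof eventually_elim
  case (elim t)
  moreover have "\<forall>w\<in>W. (z(v := t)) w = z w" using assms(4) by auto
  ultimately show ?case using assms(2,3) unfolding determined_by_def by blast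
qed

lemma partial_determined_by:
  assumes "open \<Omega>" "z \<in> \<Omega>" "determined_by \<Omega> W f" "v \<notin> W"
  shows "partial v f z = 0" "(\<lambda>t. f (z(v := t))) field_differentiable at (z v)"
proof -
  have "((\<lambda>t. f (z(v := t))) has_field_derivative 0) (at (z v))"
    using DERIV_cong_ev[OF refl eventually_determined_by[OF assms] refl] by simp
  then show "partial v f z = 0" "(\<lambda>t. f (z(v := t))) field_differentiable at (z v)"
    by (auto simp: partial_def DERIV_imp_deriv field_differentiable_def)
qed

lemma locally_analytic_inD:
  assumes "locally_analytic_in V \<Omega> f"
  shows "finite V" "determined_by \<Omega> V f"
    "\<And>p. p \<in> \<Omega> \<Longrightarrow> \<exists>c. \<forall>\<^sub>F z in nhds p.
        ((\<lambda>k. c k * (\<Prod>v\<in>#k. z v - p v)) has_sum f z) {k. set_mset k \<subseteq> V}"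
  using assms[unfolded locally_analytic_in_def, folded determined_by_def] by simp_all

lemma locally_analytic_differentiable:
  assumes "open \<Omega>" "locally_analytic_in V \<Omega> f" "z \<in> \<Omega>"
  shows "(\<lambda>t. f (z(v := t))) field_differentiable at (z v)"
proof (cases "v \<in> V")
  case True
  obtain c where "\<forall>\<^sub>F y in nhds z.
      ((\<lambda>k. c k * (\<Prod>v\<in>#k. y v - z v)) has_sum f y) {k. set_mset k \<subseteq> V}"
    using locally_analytic_inD(3)[OF assms(2,3)] by blast
  from eventually_nhds_x_imp_x[OF power_series_partial[OF this True]] show ?thesis
    by blast
next
  case False
  then show ?thesis
    using partial_determined_by(2)[OF assms(1,3) locally_analytic_inD(2)[OF assms(2)]] by blast
qed

lemma determined_by_partial:
  assumes "open \<Omega>" "determined_by \<Omega> V f"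
  shows "determined_by \<Omega> V (partial v f)"
  unfolding determined_by_def
proof (intro ballI impI)
  fix y z assume yz: "y \<in> \<Omega>" "z \<in> \<Omega>" "\<forall>w\<in>V. y w = z w"
  show "partial v f y = partial v f z"
  proof (cases "v \<in> V")
    case True
    then have [simp]: "y v = z v" using yz by auto
    have "\<forall>\<^sub>F t in nhds (z v). f (y(v := t)) = f (z(v := t))"
      using eventually_fun_upd_in_open[OF assms(1) yz(1), of v, simplified]
        eventually_fun_upd_in_open[OF assms(1) yz(2), of v]
    proof eventually_elim
      case (elim t)
      have "\<forall>w\<in>V. (y(v := t)) w = (z(v := t)) w" using yz(3) by auto
      with elim assms(2) show ?case unfolding determined_by_def by blast
    qed
    then show ?thesis unfolding partial_def by (intro deriv_cong_ev) auto
  next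
    case False
    then show ?thesis using partial_determined_by(1)[OF assms(1) _ assms(2)] yz by simp
  qed
qed

lemma locally_analytic_partial:
  assumes "open \<Omega>" "locally_analytic_in V \<Omega> f"
  shows "locally_analytic_in V \<Omega> (partial v f)"
  unfolding locally_analytic_in_def determined_by_def[symmetric]
proof (intro conjI ballI)
  show "finite V" using locally_analytic_inD[OF assms(2)] by simp
  show "determined_by \<Omega> V (partial v f)"
    using determined_by_partial[OF assms(1)] locally_analytic_inD[OF assms(2)] by blast
  fix p assume p: "p \<in> \<Omega>"
  show "\<exists>c. \<forall>\<^sub>F z in nhds p.
    ((\<lambda>k. c k * (\<Prod>v\<in>#k. z v - p v)) has_sum partial v f z) {k. set_mset k \<subseteq> V}"
  proof (cases "v \<in> V")
    case True
    obtain c where "\<forall>\<^sub>F z in nhds p.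
        ((\<lambda>k. c k * (\<Prod>v\<in>#k. z v - p v)) has_sum f z) {k. set_mset k \<subseteq> V}"
      using locally_analytic_inD(3)[OF assms(2) p] by blast
    from power_series_partial[OF this True] show ?thesis
      by (intro exI[of _ "\<lambda>k. real (count k v + 1) * c (add_mset v k)"]) (auto elim: eventually_mono)
  next
    case False
    have "\<forall>\<^sub>F z in nhds p. z \<in> \<Omega>"
      using assms(1) p by (auto simp: eventually_nhds)
    then show ?thesis
      using partial_determined_by(1)[OF assms(1) _ locally_analytic_inD(2)[OF assms(2)] False]
      by (intro exI[of _ "\<lambda>_. 0"]) (auto elim!: eventually_mono)
  qed
qed

section \<open>Symmetry of second partial derivatives\<close>

lemma power_series_at_center:
  fixes f :: "('v \<Rightarrow> real) \<Rightarrow> real"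
  assumes "\<forall>\<^sub>F z in nhds p. ((\<lambda>k. c k * (\<Prod>v\<in>#k. z v - p v)) has_sum f z) {k. set_mset k \<subseteq> V}"
  shows "f p = c {#}"
proof -
  have "((\<lambda>k. c k * (\<Prod>v\<in>#k. p v - p v)) has_sum f p) {k. set_mset k \<subseteq> V}"
    using assms by (rule eventually_nhds_x_imp_x)
  moreover have "((\<lambda>k. c k * (\<Prod>v\<in>#k. p v - p v)) has_sum c {#}) {k. set_mset k \<subseteq> V}"
  proof (rule has_sum_cong_neutral[THEN iffD1, rotated -1])
    show "((\<lambda>k. c k * (\<Prod>v\<in>#k. p v - p v)) has_sum c {#}) {{#}}"
      using has_sum_finite[of "{{#}}" "\<lambda>k. c k * (\<Prod>v\<in>#k. p v - p v)"] by simp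
    fix k assume "k \<in> {k. set_mset k \<subseteq> V} - {{#}}"
    then obtain w k' where "k = add_mset w k'" by (cases k) auto
    then show "c k * (\<Prod>v\<in>#k. p v - p v) = 0" by simp
  qed auto
  ultimately show ?thesis by (rule has_sum_unique)
qed

text \<open>Both sides are the constant coefficient of the twice differentiated series, read off at
  its centre. If one of the two variables lies outside \<open>V\<close>, both sides vanish.\<close>

lemma locally_analytic_partial_commute:
  assumes "open \<Omega>" "locally_analytic_in V \<Omega> f" "p \<in> \<Omega>"
  shows "partial v (partial w f) p = partial w (partial v f) p"
proof -
  have zero: "partial a (partial b f) p = 0" "partial b (partial a f) p = 0" if "a \<notin> V" for a b
  proof -
    note det = locally_analytic_inD(2)[OF assms(2)]
    show "partial a (partial b f) p = 0"
      using partial_determined_by(1)[OF assms(1,3) determined_by_partial[OF assms(1) det] that] .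
    have "partial b (partial a f) p = partial b (\<lambda>_. 0) p"
      using partial_determined_by(1)[OF assms(1) _ det that]
      by (intro partial_cong_open[OF assms(1,3)]) auto
    then show "partial b (partial a f) p = 0" by (simp add: partial_def)
  qed
  show ?thesis
  proof (cases "v \<in> V \<and> w \<in> V")
    case True
    obtain c where c: "\<forall>\<^sub>F z in nhds p.
        ((\<lambda>k. c k * (\<Prod>v\<in>#k. z v - p v)) has_sum f z) {k. set_mset k \<subseteq> V}"
      using locally_analytic_inD(3)[OF assms(2,3)] by blast
    \<comment> \<open>The factor is 2 for a = b and 1 otherwise, hence symmetric in \<open>a\<close>
      and \<open>b\<close>, like the multiset that indexes the coefficient.\<close>
    have eq: "partial a (partial b f) p = real (count {#a#} b + 1) * c {#a, b#}"
      if "a \<in> V" "b \<in> V" for a b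
    proof -
      have "\<forall>\<^sub>F z in nhds p. ((\<lambda>k. (real (count k b + 1) * c (add_mset b k)) * (\<Prod>v\<in>#k. z v - p v))
          has_sum partial b f z) {k. set_mset k \<subseteq> V}"
        using power_series_partial[OF c that(2)] by (rule eventually_mono) auto
      from power_series_partial[OF this that(1)]
      have "\<forall>\<^sub>F z in nhds p. ((\<lambda>k. (real (count k a + 1) *
          (real (count (add_mset a k) b + 1) * c (add_mset b (add_mset a k)))) * (\<Prod>v\<in>#k. z v - p v))
          has_sum partial a (partial b f) z) {k. set_mset k \<subseteq> V}"
        by (rule eventually_mono) auto
      from power_series_at_center[OF this] show ?thesis
        by (simp add: add_mset_commute)
    qed
    show ?thesis using True by (simp add: eq add_mset_commute)
  next
    case False
    then show ?thesis using zero by auto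
  qed
qed

section \<open>Differential functions\<close>

text \<open>Differentiability along coordinate lines, which is what the sum and product rules for
  \<open>partial\<close> require.\<close>

definition separately_differentiable :: "('v \<Rightarrow> real) set \<Rightarrow> (('v \<Rightarrow> real) \<Rightarrow> real) \<Rightarrow> bool" where
  "separately_differentiable \<Omega> f \<longleftrightarrow>
     (\<forall>z\<in>\<Omega>. \<forall>v. (\<lambda>t. f (z(v := t))) field_differentiable at (z v))"

lemma separately_differentiableD:
  "separately_differentiable \<Omega> f \<Longrightarrow> z \<in> \<Omega> \<Longrightarrow> (\<lambda>t. f (z(v := t))) field_differentiable at (z v)"
  unfolding separately_differentiable_def by blast

lemma separately_differentiable_const [simp]: "separately_differentiable \<Omega> (\<lambda>z. c)"
  unfolding separately_differentiable_def by (simp add: field_differentiable_const)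

lemma separately_differentiable_coord [simp]: "separately_differentiable \<Omega> (\<lambda>z. z w)"
  unfolding separately_differentiable_def
proof (intro ballI allI)
  fix z :: "'a \<Rightarrow> real" and v
  show "(\<lambda>t. (z(v := t)) w) field_differentiable at (z v)"
    by (cases "w = v") (simp_all add: field_differentiable_const field_differentiable_ident)
qed

lemma separately_differentiable_add:
  assumes "separately_differentiable \<Omega> f" "separately_differentiable \<Omega> g"
  shows "separately_differentiable \<Omega> (\<lambda>z. f z + g z)"
  using assms unfolding separately_differentiable_def by (simp add: field_differentiable_add)

lemma separately_differentiable_mult:
  assumes "separately_differentiable \<Omega> f" "separately_differentiable \<Omega> g"
  shows "separately_differentiable \<Omega> (\<lambda>z. f z * g z)"
  using assms unfolding separately_differentiable_def by (simp add: field_differentiable_mult)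

lemma separately_differentiable_cong:
  assumes "open \<Omega>" "separately_differentiable \<Omega> f" "\<And>z. z \<in> \<Omega> \<Longrightarrow> g z = f z"
  shows "separately_differentiable \<Omega> g"
  unfolding separately_differentiable_def
proof (intro ballI allI)
  fix z v assume z: "z \<in> \<Omega>"
  have ev: "\<forall>\<^sub>F t in nhds (z v). g (z(v := t)) = f (z(v := t))"
    using eventually_fun_upd_in_open[OF assms(1) z] by (rule eventually_mono) (rule assms(3))
  show "(\<lambda>t. g (z(v := t))) field_differentiable at (z v)"
    using separately_differentiableD[OF assms(2) z, of v] DERIV_cong_ev[OF refl ev refl]
    unfolding field_differentiable_def by simp
qed

lemma partial_const [simp]: "partial v (\<lambda>z. c) z = 0"
  by (simp add: partial_def)

lemma partial_coord: "partial v (\<lambda>z. z w) z = (if w = v then 1 else 0)"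
  by (simp add: partial_def)

lemma partial_add:
  assumes "separately_differentiable \<Omega> f" "separately_differentiable \<Omega> g" "z \<in> \<Omega>"
  shows "partial v (\<lambda>z. f z + g z) z = partial v f z + partial v g z"
  unfolding partial_def using assms by (intro deriv_add) (auto intro: separately_differentiableD)

lemma partial_mult:
  assumes "separately_differentiable \<Omega> f" "separately_differentiable \<Omega> g" "z \<in> \<Omega>"
  shows "partial v (\<lambda>z. f z * g z) z = f z * partial v g z + partial v f z * g z"
  unfolding partial_def using assms
  by (subst deriv_mult) (auto intro: separately_differentiableD)

lemma determined_by_mono: "determined_by \<Omega> V f \<Longrightarrow> V \<subseteq> W \<Longrightarrow> determined_by \<Omega> W f"
  unfolding determined_by_def by blast

lemma determined_by_const [simp]: "determined_by \<Omega> V (\<lambda>z. c)"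
  unfolding determined_by_def by blast

lemma determined_by_coord: "v \<in> V \<Longrightarrow> determined_by \<Omega> V (\<lambda>z. z v)"
  unfolding determined_by_def by blast

lemma determined_by_add:
  "determined_by \<Omega> V f \<Longrightarrow> determined_by \<Omega> V g \<Longrightarrow> determined_by \<Omega> V (\<lambda>z. f z + g z)"
  unfolding determined_by_def by metis

lemma determined_by_mult:
  "determined_by \<Omega> V f \<Longrightarrow> determined_by \<Omega> V g \<Longrightarrow> determined_by \<Omega> V (\<lambda>z. f z * g z)"
  unfolding determined_by_def by metis

lemma determined_by_cong:
  "determined_by \<Omega> V f \<Longrightarrow> (\<And>z. z \<in> \<Omega> \<Longrightarrow> g z = f z) \<Longrightarrow> determined_by \<Omega> V g"
  unfolding determined_by_def by metis

text \<open>
  The inductive closure replaces products of power series: each property below is checked on analytic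
  functions and propagated by the Leibniz rule.  Only the values on \<open>\<Omega>\<close> matter.
\<close>

inductive differential_function ::
  "('v \<Rightarrow> real) set \<Rightarrow> 'v set \<Rightarrow> (('v \<Rightarrow> real) \<Rightarrow> real) \<Rightarrow> bool" for \<Omega> V where
  analytic: "locally_analytic_in W \<Omega> f \<Longrightarrow> W \<subseteq> V \<Longrightarrow> differential_function \<Omega> V f"
| coord: "v \<in> V \<Longrightarrow> differential_function \<Omega> V (\<lambda>z. z v)"
| const: "differential_function \<Omega> V (\<lambda>z. c)"
| add: "differential_function \<Omega> V f \<Longrightarrow> differential_function \<Omega> V g \<Longrightarrow>
    differential_function \<Omega> V (\<lambda>z. f z + g z)"
| mult: "differential_function \<Omega> V f \<Longrightarrow> differential_function \<Omega> V g \<Longrightarrow>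
    differential_function \<Omega> V (\<lambda>z. f z * g z)"
| cong: "differential_function \<Omega> V f \<Longrightarrow> (\<And>z. z \<in> \<Omega> \<Longrightarrow> g z = f z) \<Longrightarrow> differential_function \<Omega> V g"

lemma differential_function_sum:
  "(\<And>a. a \<in> A \<Longrightarrow> differential_function \<Omega> V (f a)) \<Longrightarrow>
    differential_function \<Omega> V (\<lambda>z. \<Sum>a\<in>A. f a z)"
  by (induction A rule: infinite_finite_induct)
    (auto intro: differential_function.const differential_function.add)

lemma differential_function_diff:
  assumes "differential_function \<Omega> V f" "differential_function \<Omega> V g"
  shows "differential_function \<Omega> V (\<lambda>z. f z - g z)"
  using differential_function.add[OF assms(1)
      differential_function.mult[OF differential_function.const[of _ _ "-1"] assms(2)]]
  by (rule differential_function.cong) simp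

lemma differential_function_mono:
  assumes "differential_function \<Omega> V f" "V \<subseteq> V'"
  shows "differential_function \<Omega> V' f"
  using assms(1)
proof induction
  case (analytic W f)
  show ?case
    using analytic(1) subset_trans[OF analytic(2) assms(2)] by (rule differential_function.analytic)
next
  case (coord v)
  show ?case using subsetD[OF assms(2) coord] by (rule differential_function.coord)
next
  case (cong f g)
  show ?case using cong(3,2) by (rule differential_function.cong)
qed (rule differential_function.intros; assumption)+

text \<open>In the applications \<open>V\<close> is infinite: all coordinates, or all but the
  nonlocal ones. The finite \<open>W\<close> inside it is what turns total differentiation into a
  finite sum.\<close>

lemma differential_function_determined_by:
  assumes "differential_function \<Omega> V f"
  obtains W where "finite W" "W \<subseteq> V" "determined_by \<Omega> W f"
proof -
  from assms have "\<exists>W. finite W \<and> W \<subseteq> V \<and> determined_by \<Omega> W f"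
  proof induction
    case (analytic W f)
    then show ?case using locally_analytic_inD(1,2)[OF analytic(1)] by (intro exI[of _ W]) simp
  next
    case (coord v)
    then show ?case by (intro exI[of _ "{v}"]) (simp add: determined_by_coord)
  next
    case (const c)
    then show ?case by (intro exI[of _ "{}"]) simp
  next
    case (add f g)
    then obtain A B where "finite A" "A \<subseteq> V" "determined_by \<Omega> A f"
      "finite B" "B \<subseteq> V" "determined_by \<Omega> B g" by blast
    moreover from this have "determined_by \<Omega> (A \<union> B) f" "determined_by \<Omega> (A \<union> B) g"
      by (meson determined_by_mono Un_upper1 Un_upper2)+
    ultimately show ?case
      by (intro exI[of _ "A \<union> B"]) (simp add: determined_by_add)
  next
    case (mult f g)
    then obtain A B where "finite A" "A \<subseteq> V" "determined_by \<Omega> A f"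
      "finite B" "B \<subseteq> V" "determined_by \<Omega> B g" by blast
    moreover from this have "determined_by \<Omega> (A \<union> B) f" "determined_by \<Omega> (A \<union> B) g"
      by (meson determined_by_mono Un_upper1 Un_upper2)+
    ultimately show ?case
      by (intro exI[of _ "A \<union> B"]) (simp add: determined_by_mult)
  next
    case (cong f g)
    then obtain A where "finite A" "A \<subseteq> V" "determined_by \<Omega> A f" by blast
    moreover from this(3) cong(2) have "determined_by \<Omega> A g" by (rule determined_by_cong)
    ultimately show ?case by (intro exI[of _ A]) simp
  qed
  then show thesis using that by blast
qed

lemma differential_function_separately_differentiable:
  assumes "open \<Omega>" "differential_function \<Omega> V f"
  shows "separately_differentiable \<Omega> f"
  using assms(2)
proof induction
  case (analytic W f)
  show ?case
    unfolding separately_differentiable_def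
    using locally_analytic_differentiable[OF assms(1) analytic(1)] by blast
qed (simp_all add: separately_differentiable_add separately_differentiable_mult
    separately_differentiable_cong[OF assms(1)])

lemma differential_function_partial:
  assumes "open \<Omega>" "differential_function \<Omega> V f"
  shows "differential_function \<Omega> V (partial v f)"
  using assms(2)
proof induction
  case (analytic W f)
  then show ?case
    using differential_function.analytic[OF locally_analytic_partial[OF assms(1)]] by simp
next
  case (coord w)
  show ?case
    using differential_function.const by (rule differential_function.cong) (rule partial_coord)
next
  case (const c)
  show ?case
    using differential_function.const by (rule differential_function.cong) (rule partial_const)
next
  case (add f g)
  note sd = differential_function_separately_differentiable[OF assms(1)]
  show ?case
    using differential_function.add[OF add(3,4)]
    by (rule differential_function.cong) (rule partial_add[OF sd[OF add(1)] sd[OF add(2)]])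
next
  case (mult f g)
  note sd = differential_function_separately_differentiable[OF assms(1)]
  show ?case
    using differential_function.add[OF differential_function.mult[OF mult(1,4)]
        differential_function.mult[OF mult(3,2)]]
    by (rule differential_function.cong) (rule partial_mult[OF sd[OF mult(1)] sd[OF mult(2)]])
next
  case (cong f g)
  show ?case
    using cong(3) by (rule differential_function.cong) (rule partial_cong_open[OF assms(1) _ cong(2)])
qed

lemma differential_function_partial_commute:
  assumes "open \<Omega>" "differential_function \<Omega> V f" "z \<in> \<Omega>"
  shows "partial v (partial w f) z = partial w (partial v f) z"
  using assms(2,3)
proof (induction arbitrary: z)
  case (analytic W f)
  then show ?case using locally_analytic_partial_commute[OF assms(1)] by simp
next
  case (coord u)
  then show ?case by (simp add: partial_coord[abs_def])
next
  case (const c)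
  then show ?case by (simp add: partial_const[abs_def])
next
  case (add f g)
  note sd = differential_function_separately_differentiable[OF assms(1)]
  have "partial v (partial w (\<lambda>z. f z + g z)) z =
      partial v (partial w f) z + partial v (partial w g) z" for v w
  proof -
    have "partial v (partial w (\<lambda>z. f z + g z)) z = partial v (\<lambda>z. partial w f z + partial w g z) z"
      using assms(1) add.prems
      by (rule partial_cong_open) (rule partial_add[OF sd[OF add(1)] sd[OF add(2)]])
    also have "\<dots> = partial v (partial w f) z + partial v (partial w g) z"
      using add by (intro partial_add[where \<Omega> = \<Omega>] sd differential_function_partial[OF assms(1)])
    finally show ?thesis .
  qed
  then show ?case using add by simp
next
  case (mult f g)
  note sd = differential_function_separately_differentiable[OF assms(1)]
  note sdp = sd[OF differential_function_partial[OF assms(1)]]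
  \<comment> \<open>Exchanging \<open>v\<close> and \<open>w\<close> swaps the two products of first
    derivatives; the second-order terms agree by induction.\<close>
  have "partial v (partial w (\<lambda>z. f z * g z)) z =
      f z * partial v (partial w g) z + partial v f z * partial w g z
      + (partial w f z * partial v g z + partial v (partial w f) z * g z)" for v w
  proof -
    have "partial v (partial w (\<lambda>z. f z * g z)) z =
        partial v (\<lambda>z. f z * partial w g z + partial w f z * g z) z"
      using assms(1) mult.prems
      by (rule partial_cong_open) (rule partial_mult[OF sd[OF mult(1)] sd[OF mult(2)]])
    also have "\<dots> = partial v (\<lambda>z. f z * partial w g z) z + partial v (\<lambda>z. partial w f z * g z) z"
      using mult by (intro partial_add[where \<Omega> = \<Omega>] separately_differentiable_mult sd sdp)
    also have "\<dots> = f z * partial v (partial w g) z + partial v f z * partial w g z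
        + (partial w f z * partial v g z + partial v (partial w f) z * g z)"
      using partial_mult[OF sd[OF mult(1)] sdp[OF mult(2)] mult.prems]
        partial_mult[OF sdp[OF mult(1)] sd[OF mult(2)] mult.prems] by simp
    finally show ?thesis .
  qed
  then show ?case using mult by simp
next
  case (cong f g)
  have "partial v (partial w g) z = partial v (partial w f) z" for v w
    using assms(1) cong.prems
    by (rule partial_cong_open) (rule partial_cong_open[OF assms(1) _ cong(2)])
  then show ?case using cong by simp
qed

section \<open>Total differentiation as a derivation\<close>

text \<open>At \<open>ordered z\<close> all orderings of J carry the value of u_J, and the mean
  gives each the weight 1/N, where N is the number of orderings. A change of one of them thus moves
  u_J by 1/N of that change.\<close>

lemma symmetrize_ordered_upd:
  fixes z :: "('n, 'd, 'k) jet" and d :: 'd and l :: "'n list"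
  defines "v \<equiv> Dep d (mset l)"
  shows "symmetrize ((ordered z)(Dep d l := t)) =
    z(v := z v + (t - z v) / real (card (permutations_of_multiset (mset l))))"
proof
  fix w :: "('n, 'd, 'n multiset, 'k) jet_var"
  show "symmetrize ((ordered z)(Dep d l := t)) w =
    (z(v := z v + (t - z v) / real (card (permutations_of_multiset (mset l))))) w"
  proof (cases w)
    case (Dep e J)
    let ?P = "permutations_of_multiset J"
    have fin: "finite ?P" and pos: "card ?P > 0"
      by (simp_all add: card_gt_0_iff)
    show ?thesis
    proof (cases "e = d \<and> J = mset l")
      case True
      have "(\<Sum>k\<in>?P. ((ordered z)(Dep d l := t)) (Dep e k))
          = (\<Sum>k\<in>?P. z v + (if k = l then t - z v else 0))"
        using True by (intro sum.cong)
          (auto simp: ordered_def v_def dest!: permutations_of_multisetD)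
      also have "\<dots> = real (card ?P) * z v + (t - z v)"
        using fin True by (simp add: sum.distrib sum.delta permutations_of_multisetI)
      finally show ?thesis
        using True pos Dep by (simp add: symmetrize_def v_def field_simps)
    next
      case False
      have "(\<Sum>k\<in>?P. ((ordered z)(Dep d l := t)) (Dep e k)) = (\<Sum>k\<in>?P. z (Dep e J))"
        using False by (intro sum.cong)
          (auto simp: ordered_def dest!: permutations_of_multisetD)
      then show ?thesis
        using False pos Dep by (auto simp: symmetrize_def v_def)
    qed
  qed (auto simp: symmetrize_def ordered_def v_def)
qed

lemma dpartial_eq_deriv:
  fixes z :: "('n, 'd, 'k) jet" and d :: 'd and l :: "'n list"
  defines "v \<equiv> Dep d (mset l)" and "c \<equiv> real (card (permutations_of_multiset (mset l)))"
  shows "dpartial d l f z = deriv (\<lambda>t. f (z(v := z v + (t - z v) / c))) (z v)"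
  unfolding dpartial_def partial_def symmetric_form_def symmetrize_ordered_upd v_def c_def
  by (simp add: ordered_def)

text \<open>Chain rule for an affine map of slope 1/N: for instance, the derivative of the symmetric
  form by u_xy is half the ordinary one, and summing over the orderings restores the latter.\<close>

lemma dpartial_eq_partial:
  fixes z :: "('n, 'd, 'k) jet" and l :: "'n list"
  assumes "(\<lambda>t. f (z(Dep d (mset l) := t))) field_differentiable at (z (Dep d (mset l)))"
  shows "dpartial d l f z =
    partial (Dep d (mset l)) f z / real (card (permutations_of_multiset (mset l)))"
proof -
  let ?v = "Dep d (mset l) :: ('n, 'd, 'n multiset, 'k) jet_var"
  let ?c = "real (card (permutations_of_multiset (mset l)))"
  have "((\<lambda>t. f (z(?v := t))) has_field_derivative partial ?v f z) (at (z ?v + (z ?v - z ?v) / ?c))"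
    using assms DERIV_deriv_iff_field_differentiable unfolding partial_def by fastforce
  then have "((\<lambda>t. f (z(?v := z ?v + (t - z ?v) / ?c))) has_field_derivative partial ?v f z * (1 / ?c))
      (at (z ?v))"
    by (rule DERIV_chain2[where f = "\<lambda>t. f (z(?v := t))" and g = "\<lambda>t. z ?v + (t - z ?v) / ?c"])
      (auto intro!: derivative_eq_intros)
  then show ?thesis
    unfolding dpartial_eq_deriv by (simp add: DERIV_imp_deriv)
qed

lemma dpartial_cong_open:
  fixes z :: "('n, 'd, 'k) jet" and l :: "'n list"
  assumes "open \<Omega>" "z \<in> \<Omega>" "\<And>y. y \<in> \<Omega> \<Longrightarrow> f y = g y"
  shows "dpartial d l f z = dpartial d l g z"
proof -
  let ?v = "Dep d (mset l) :: ('n, 'd, 'n multiset, 'k) jet_var"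
  let ?c = "real (card (permutations_of_multiset (mset l)))"
  have "isCont (\<lambda>t. z ?v + (t - z ?v) / ?c) (z ?v)"
    by (intro continuous_intros) simp
  then have "((\<lambda>t. z ?v + (t - z ?v) / ?c) \<longlongrightarrow> z ?v + (z ?v - z ?v) / ?c) (nhds (z ?v))"
    unfolding isCont_def by (rule tendsto_at_iff_tendsto_nhds[THEN iffD1])
  then have "((\<lambda>t. z ?v + (t - z ?v) / ?c) \<longlongrightarrow> z ?v) (nhds (z ?v))"
    by simp
  from filterlim_iff[THEN iffD1, OF this, rule_format, OF eventually_fun_upd_in_open[OF assms(1,2)]]
  have "\<forall>\<^sub>F t in nhds (z ?v). z(?v := z ?v + (t - z ?v) / ?c) \<in> \<Omega>" .
  then have "\<forall>\<^sub>F t in nhds (z ?v). f (z(?v := z ?v + (t - z ?v) / ?c))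
      = g (z(?v := z ?v + (t - z ?v) / ?c))"
    by (rule eventually_mono) (rule assms(3))
  then show ?thesis
    unfolding dpartial_eq_deriv by (rule deriv_cong_ev) simp
qed

section \<open>Total differentiation as a finite sum over coordinates\<close>

text \<open>The regularity that makes \<open>total_diff\<close> a finite sum obeying the Leibniz
  rule. It carries over to functions composed with \<open>forget_v\<close> and to terms linear in
  the auxiliary variables.\<close>

definition finitely_differentiable :: "('v \<Rightarrow> real) set \<Rightarrow> (('v \<Rightarrow> real) \<Rightarrow> real) \<Rightarrow> bool" where
  "finitely_differentiable \<Omega> f \<longleftrightarrow>
     separately_differentiable \<Omega> f \<and> (\<exists>W. finite W \<and> determined_by \<Omega> W f)"

text \<open>The components of D_i as a vector field on jet space: D_i applied to the coordinate
  \<open>v\<close>, as \<open>total_diff_coord\<close> confirms.\<close>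

definition total_coeff ::
  "'k set \<Rightarrow> ('k \<Rightarrow> 'n \<Rightarrow> ('n, 'd, 'k) jet \<Rightarrow> real) \<Rightarrow> 'n
    \<Rightarrow> ('n, 'd, 'n multiset, 'k) jet_var \<Rightarrow> ('n, 'd, 'k) jet \<Rightarrow> real" where
  "total_coeff K G i v z = (case v of
       Indep j \<Rightarrow> if j = i then 1 else 0
     | Dep d J \<Rightarrow> z (Dep d (add_mset i J))
     | Nonloc a \<Rightarrow> if a \<in> K then G a i z else 0)"

lemma sum_lists_by_mset:
  fixes h :: "'n multiset \<Rightarrow> real"
  assumes "finite A"
  shows "finite {l. mset l \<in> A}"
    "(\<Sum>l | mset l \<in> A. h (mset l) / real (card (permutations_of_multiset (mset l)))) = (\<Sum>J\<in>A. h J)"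
proof -
  have eq: "{l. mset l \<in> A} = (\<Union>J\<in>A. permutations_of_multiset J)"
    by (auto simp: permutations_of_multiset_def)
  show "finite {l. mset l \<in> A}"
    unfolding eq using assms by auto
  have "(\<Sum>l\<in>permutations_of_multiset J. h (mset l) / real (card (permutations_of_multiset (mset l))))
      = h J" for J
  proof -
    have "card (permutations_of_multiset J) > 0" by (simp add: card_gt_0_iff)
    moreover have "(\<Sum>l\<in>permutations_of_multiset J. h (mset l) / real (card (permutations_of_multiset (mset l))))
        = (\<Sum>l\<in>permutations_of_multiset J. h J / real (card (permutations_of_multiset J)))"
      by (intro sum.cong) (auto simp: permutations_of_multiset_def)
    ultimately show ?thesis by simp
  qed
  then show "(\<Sum>l | mset l \<in> A. h (mset l) / real (card (permutations_of_multiset (mset l)))) = (\<Sum>J\<in>A. h J)"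
    unfolding eq using assms
    by (subst sum.UNION_disjoint) (simp_all, auto simp: permutations_of_multiset_def)
qed

text \<open>The weights 1/N of the symmetric form cancel against the N orderings of each J, leaving
  the vector field D_i in the multiset coordinates. Any finite \<open>W\<close> that determines
  \<open>f\<close> will do, so two functions can be expanded over a common \<open>W\<close>; the sum
  and product rules then come from those of \<open>partial\<close>.\<close>

lemma total_diff_eq_sum:
  fixes f :: "('n, 'd::finite, 'k) jet \<Rightarrow> real"
  assumes "open \<Omega>" "separately_differentiable \<Omega> f" "finite W" "determined_by \<Omega> W f" "z \<in> \<Omega>" "finite K"
  shows "total_diff K G i f z = (\<Sum>v\<in>W. total_coeff K G i v z * partial v f z)"
proof -
  let ?h = "\<lambda>v. total_coeff K G i v z * partial v f z"
  have zero: "partial v f z = 0" if "v \<notin> W" for v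
    using partial_determined_by(1)[OF assms(1,5,4) that] .
  define A where "A = {j. Indep j \<in> W}"
  define B where "B d = {J. Dep d J \<in> W}" for d
  define C where "C = {a. Nonloc a \<in> W}"
  have fin: "finite A" "\<And>d. finite (B d)" "finite C"
    unfolding A_def B_def C_def using assms(3)
    by (auto intro!: finite_vimageI[unfolded vimage_def] simp: inj_on_def)
  have W: "W = Indep ` A \<union> (\<lambda>(d, J). Dep d J) ` Sigma UNIV B \<union> Nonloc ` C" (is "_ = ?A \<union> ?B \<union> ?C")
  proof (intro set_eqI iffI)
    fix v assume "v \<in> W" then show "v \<in> ?A \<union> ?B \<union> ?C"
      by (cases v) (auto simp: A_def B_def C_def image_iff)
  qed (auto simp: A_def B_def C_def)
  have finB: "finite (Sigma UNIV B)"
    using fin by (intro finite_SigmaI) auto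
  have "sum ?h W = sum ?h (?A \<union> ?B) + sum ?h ?C"
    by (subst (1) W, rule sum.union_disjoint) (use fin finB in auto)
  also have "sum ?h (?A \<union> ?B) = sum ?h ?A + sum ?h ?B"
    by (rule sum.union_disjoint) (use fin finB in auto)
  also have "sum ?h ?A = partial (Indep i) f z"
  proof -
    have "sum ?h ?A = (\<Sum>j\<in>A. if j = i then partial (Indep i) f z else 0)"
      by (subst sum.reindex) (auto simp: inj_on_def total_coeff_def intro!: sum.cong)
    also have "\<dots> = (if i \<in> A then partial (Indep i) f z else 0)"
      using fin by (simp add: sum.delta')
    also have "\<dots> = partial (Indep i) f z"
      using zero by (auto simp: A_def)
    finally show ?thesis .
  qed
  also have "sum ?h ?C = (\<Sum>a\<in>K. G a i z * partial (Nonloc a) f z)"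
  proof -
    have "sum ?h ?C = (\<Sum>a\<in>C. if a \<in> K then G a i z * partial (Nonloc a) f z else 0)"
      by (subst sum.reindex) (auto simp: inj_on_def total_coeff_def intro!: sum.cong)
    also have "\<dots> = (\<Sum>a\<in>C \<inter> K. G a i z * partial (Nonloc a) f z)"
      using fin by (simp add: sum.inter_restrict)
    also have "\<dots> = (\<Sum>a\<in>K. G a i z * partial (Nonloc a) f z)"
      using assms(6) zero by (intro sum.mono_neutral_left) (auto simp: C_def)
    finally show ?thesis .
  qed
  also have "sum ?h ?B = (\<Sum>d\<in>UNIV. \<Sum>J\<in>B d. z (Dep d (add_mset i J)) * partial (Dep d J) f z)"
    by (subst sum.reindex)
      (auto simp: inj_on_def total_coeff_def sum.Sigma fin intro!: sum.cong)
  also have "\<dots> = (\<Sum>d\<in>UNIV. Sum_any (\<lambda>l. z (Dep d (mset (i # l))) * dpartial d l f z))"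
  proof (rule sum.cong)
    fix d
    let ?g = "\<lambda>J. z (Dep d (add_mset i J)) * partial (Dep d J) f z"
    have dp: "z (Dep d (mset (i # l))) * dpartial d l f z
        = ?g (mset l) / real (card (permutations_of_multiset (mset l)))" for l
      using dpartial_eq_partial[OF separately_differentiableD[OF assms(2,5)], of d l] by simp
    have "Sum_any (\<lambda>l. z (Dep d (mset (i # l))) * dpartial d l f z)
        = (\<Sum>l | mset l \<in> B d. ?g (mset l) / real (card (permutations_of_multiset (mset l))))"
      unfolding dp using zero
      by (intro Sum_any.expand_superset sum_lists_by_mset(1) fin) (auto simp: B_def)
    also have "\<dots> = (\<Sum>J\<in>B d. ?g J)"
      by (rule sum_lists_by_mset(2)) (rule fin)
    finally show "(\<Sum>J\<in>B d. ?g J) = Sum_any (\<lambda>l. z (Dep d (mset (i # l))) * dpartial d l f z)" ..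
  qed simp
  finally show ?thesis
    unfolding total_diff_def by simp
qed

lemma total_diff_cong_open:
  fixes f :: "('n, 'd::finite, 'k) jet \<Rightarrow> real"
  assumes "open \<Omega>" "z \<in> \<Omega>" "\<And>y. y \<in> \<Omega> \<Longrightarrow> f y = g y"
  shows "total_diff K G i f z = total_diff K G i g z"
  unfolding total_diff_def
  by (simp add: partial_cong_open[OF assms] dpartial_cong_open[OF assms])

lemma total_diffs_cong_open:
  fixes f :: "('n, 'd::finite, 'k) jet \<Rightarrow> real"
  assumes "open \<Omega>" "z \<in> \<Omega>" "\<And>y. y \<in> \<Omega> \<Longrightarrow> f y = g y"
  shows "total_diffs K G l f z = total_diffs K G l g z"
  using assms(2)
proof (induction l arbitrary: z)
  case (Cons i l)
  then show ?case by (simp add: total_diff_cong_open[OF assms(1) _ Cons.IH])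
qed (simp add: assms(3))

lemma finitely_differentiable_common_support:
  assumes "finitely_differentiable \<Omega> f" "finitely_differentiable \<Omega> g"
  obtains W where "finite W" "determined_by \<Omega> W f" "determined_by \<Omega> W g"
proof -
  from assms obtain A B where "finite A" "determined_by \<Omega> A f" "finite B" "determined_by \<Omega> B g"
    unfolding finitely_differentiable_def by blast
  then show thesis
    by (intro that[of "A \<union> B"]) (auto elim: determined_by_mono)
qed

lemma finitely_differentiable_add:
  assumes "finitely_differentiable \<Omega> f" "finitely_differentiable \<Omega> g"
  shows "finitely_differentiable \<Omega> (\<lambda>z. f z + g z)"
  using assms finitely_differentiable_common_support[OF assms]
  unfolding finitely_differentiable_def
  by (metis determined_by_add separately_differentiable_add)

lemma finitely_differentiable_mult:
  assumes "finitely_differentiable \<Omega> f" "finitely_differentiable \<Omega> g"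
  shows "finitely_differentiable \<Omega> (\<lambda>z. f z * g z)"
  using assms finitely_differentiable_common_support[OF assms]
  unfolding finitely_differentiable_def
  by (metis determined_by_mult separately_differentiable_mult)

lemma finitely_differentiable_const [simp]: "finitely_differentiable \<Omega> (\<lambda>z. c)"
  unfolding finitely_differentiable_def by (auto intro: exI[of _ "{}"])

lemma finitely_differentiable_coord [simp]: "finitely_differentiable \<Omega> (\<lambda>z. z w)"
  unfolding finitely_differentiable_def by (auto intro: exI[of _ "{w}"] determined_by_coord)

lemma finitely_differentiable_sum:
  "(\<And>a. a \<in> A \<Longrightarrow> finitely_differentiable \<Omega> (f a)) \<Longrightarrow> finitely_differentiable \<Omega> (\<lambda>z. \<Sum>a\<in>A. f a z)"
  by (induction A rule: infinite_finite_induct) (simp_all add: finitely_differentiable_add)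

lemma differential_function_finitely_differentiable:
  assumes "open \<Omega>" "differential_function \<Omega> V f"
  shows "finitely_differentiable \<Omega> f"
  using differential_function_separately_differentiable[OF assms]
    differential_function_determined_by[OF assms(2)]
  unfolding finitely_differentiable_def by metis

lemma total_diff_add:
  fixes f g :: "('n, 'd::finite, 'k) jet \<Rightarrow> real"
  assumes "open \<Omega>" "finite K" "finitely_differentiable \<Omega> f" "finitely_differentiable \<Omega> g" "z \<in> \<Omega>"
  shows "total_diff K G i (\<lambda>z. f z + g z) z = total_diff K G i f z + total_diff K G i g z"
proof -
  from finitely_differentiable_common_support[OF assms(3,4)] obtain W where
    W: "finite W" "determined_by \<Omega> W f" "determined_by \<Omega> W g" .
  have sd: "separately_differentiable \<Omega> f" "separately_differentiable \<Omega> g"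
    using assms unfolding finitely_differentiable_def by blast+
  have "total_diff K G i (\<lambda>z. f z + g z) z =
      (\<Sum>v\<in>W. total_coeff K G i v z * partial v (\<lambda>z. f z + g z) z)"
    using assms W sd
    by (intro total_diff_eq_sum separately_differentiable_add determined_by_add)
  also have "\<dots> = (\<Sum>v\<in>W. total_coeff K G i v z * partial v f z)
      + (\<Sum>v\<in>W. total_coeff K G i v z * partial v g z)"
    by (simp add: partial_add[OF sd assms(5)] sum.distrib distrib_left)
  also have "\<dots> = total_diff K G i f z + total_diff K G i g z"
    using total_diff_eq_sum[OF assms(1) sd(1) W(1,2) assms(5,2)]
      total_diff_eq_sum[OF assms(1) sd(2) W(1,3) assms(5,2)] by simp
  finally show ?thesis .
qed

lemma total_diff_mult:
  fixes f g :: "('n, 'd::finite, 'k) jet \<Rightarrow> real"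
  assumes "open \<Omega>" "finite K" "finitely_differentiable \<Omega> f" "finitely_differentiable \<Omega> g" "z \<in> \<Omega>"
  shows "total_diff K G i (\<lambda>z. f z * g z) z = f z * total_diff K G i g z + total_diff K G i f z * g z"
proof -
  from finitely_differentiable_common_support[OF assms(3,4)] obtain W where
    W: "finite W" "determined_by \<Omega> W f" "determined_by \<Omega> W g" .
  have sd: "separately_differentiable \<Omega> f" "separately_differentiable \<Omega> g"
    using assms unfolding finitely_differentiable_def by blast+
  have "total_diff K G i (\<lambda>z. f z * g z) z =
      (\<Sum>v\<in>W. total_coeff K G i v z * partial v (\<lambda>z. f z * g z) z)"
    using assms W sd
    by (intro total_diff_eq_sum separately_differentiable_mult determined_by_mult)
  also have "\<dots> = f z * (\<Sum>v\<in>W. total_coeff K G i v z * partial v g z)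
      + (\<Sum>v\<in>W. total_coeff K G i v z * partial v f z) * g z"
    by (simp add: partial_mult[OF sd assms(5)] sum.distrib[symmetric] sum_distrib_left
        sum_distrib_right algebra_simps)
  also have "\<dots> = f z * total_diff K G i g z + total_diff K G i f z * g z"
    using total_diff_eq_sum[OF assms(1) sd(1) W(1,2) assms(5,2)]
      total_diff_eq_sum[OF assms(1) sd(2) W(1,3) assms(5,2)] by simp
  finally show ?thesis .
qed

lemma total_diff_const [simp]: "total_diff K G i (\<lambda>z. c) z = 0"
proof -
  have "dpartial d l (\<lambda>z. c) z = 0" for d l
    by (simp add: dpartial_def symmetric_form_def[abs_def])
  then show ?thesis by (simp add: total_diff_def)
qed

lemma total_diffs_zero [simp]: "total_diffs K G l (\<lambda>z. 0) = (\<lambda>z. 0)"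
  by (induction l) (auto intro!: ext)

lemma total_diff_cmult:
  fixes f :: "('n, 'd::finite, 'k) jet \<Rightarrow> real"
  assumes "open \<Omega>" "finite K" "finitely_differentiable \<Omega> f" "z \<in> \<Omega>"
  shows "total_diff K G i (\<lambda>z. c * f z) z = c * total_diff K G i f z"
  using total_diff_mult[OF assms(1,2) finitely_differentiable_const assms(3,4), of G i c] by simp

lemma total_diff_sum:
  fixes f :: "'a \<Rightarrow> ('n, 'd::finite, 'k) jet \<Rightarrow> real"
  assumes "open \<Omega>" "finite K" "\<And>a. a \<in> A \<Longrightarrow> finitely_differentiable \<Omega> (f a)" "z \<in> \<Omega>"
  shows "total_diff K G i (\<lambda>z. \<Sum>a\<in>A. f a z) z = (\<Sum>a\<in>A. total_diff K G i (f a) z)"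
  using assms(3)
  by (induction A rule: infinite_finite_induct)
    (simp_all add: total_diff_add[OF assms(1,2) _ _ assms(4)] finitely_differentiable_sum)

lemma total_diff_coord:
  fixes z :: "('n, 'd::finite, 'k) jet"
  assumes "finite K"
  shows "total_diff K G i (\<lambda>z. z v) z = total_coeff K G i v z"
proof -
  have "total_diff K G i (\<lambda>z. z v) z =
      (\<Sum>w\<in>{v}. total_coeff K G i w z * partial w (\<lambda>z. z v) z)"
    using assms by (intro total_diff_eq_sum[where \<Omega> = UNIV]) (simp_all add: determined_by_coord)
  then show ?thesis by (simp add: partial_coord)
qed

section \<open>Differential functions under total differentiation\<close>

lemma differential_function_dpartial:
  fixes f :: "('n, 'd, 'k) jet \<Rightarrow> real"
  assumes "open \<Omega>" "differential_function \<Omega> V f"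
  shows "differential_function \<Omega> V (dpartial d l f)"
proof (rule differential_function.cong)
  let ?c = "real (card (permutations_of_multiset (mset l)))"
  show "differential_function \<Omega> V (\<lambda>z. 1 / ?c * partial (Dep d (mset l)) f z)"
    by (intro differential_function.mult differential_function.const
        differential_function_partial[OF assms])
  fix z assume "z \<in> \<Omega>"
  from dpartial_eq_partial[OF separately_differentiableD
      [OF differential_function_separately_differentiable[OF assms] this]]
  show "dpartial d l f z = 1 / ?c * partial (Dep d (mset l)) f z"
    by simp
qed

lemma dpartial_determined_by:
  fixes f :: "('n, 'd, 'k) jet \<Rightarrow> real"
  assumes "open \<Omega>" "determined_by \<Omega> W f" "z \<in> \<Omega>" "Dep d (mset l) \<notin> W"
  shows "dpartial d l f z = 0"
  using dpartial_eq_partial[OF partial_determined_by(2)[OF assms(1,3,2,4)]]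
    partial_determined_by(1)[OF assms(1,3,2,4)] by simp

lemma dpartial_mset:
  fixes f :: "('n, 'd, 'k) jet \<Rightarrow> real"
  assumes "mset l = mset l'"
  shows "dpartial d l f z = dpartial d l' f z"
  unfolding dpartial_eq_deriv assms ..

text \<open>D_i raises the order, so \<open>V\<close> must contain all derivatives of the dependent
  variables. The condition on \<open>G\<close> concerns the nonlocal variables in \<open>V\<close>:
  it is empty for local functions, where \<open>V\<close> is \<open>- range Nonloc\<close>, and
  covers the whole defining system when \<open>V\<close> is \<open>UNIV\<close>.\<close>

lemma differential_function_total_diff:
  fixes f :: "('n, 'd::finite, 'k) jet \<Rightarrow> real"
  assumes "open \<Omega>" "finite K" "differential_function \<Omega> V f" "\<And>d J. Dep d J \<in> V"
    and G: "\<And>a i. a \<in> K \<Longrightarrow> Nonloc a \<in> V \<Longrightarrow> differential_function \<Omega> V (G a i)"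
  shows "differential_function \<Omega> V (total_diff K G i f)"
proof -
  obtain W where W: "finite W" "W \<subseteq> V" "determined_by \<Omega> W f"
    using differential_function_determined_by[OF assms(3)] .
  have "differential_function \<Omega> V (total_coeff K G i v)" if "v \<in> V" for v
  proof (cases v)
    case (Indep j)
    then show ?thesis by (simp add: total_coeff_def[abs_def] differential_function.const)
  next
    case (Dep d J)
    then show ?thesis by (simp add: total_coeff_def[abs_def] differential_function.coord assms(4))
  next
    case (Nonloc a)
    then show ?thesis using that
      by (cases "a \<in> K") (simp_all add: total_coeff_def[abs_def] G differential_function.const)
  qed
  then have "differential_function \<Omega> V (\<lambda>z. \<Sum>v\<in>W. total_coeff K G i v z * partial v f z)"
    using W(2) by (intro differential_function_sum differential_function.mult
        differential_function_partial[OF assms(1,3)]) blast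
  then show ?thesis
    by (rule differential_function.cong)
      (rule total_diff_eq_sum[OF assms(1)
          differential_function_separately_differentiable[OF assms(1,3)] W(1,3) _ assms(2)])
qed

lemma differential_function_total_diffs:
  fixes f :: "('n, 'd::finite, 'k) jet \<Rightarrow> real"
  assumes "open \<Omega>" "finite K" "differential_function \<Omega> V f" "\<And>d J. Dep d J \<in> V"
    and "\<And>a i. a \<in> K \<Longrightarrow> Nonloc a \<in> V \<Longrightarrow> differential_function \<Omega> V (G a i)"
  shows "differential_function \<Omega> V (total_diffs K G l f)"
proof (induction l)
  case (Cons i l)
  have "differential_function \<Omega> V (total_diff K G i (total_diffs K G l f))"
    by (rule differential_function_total_diff) (use assms Cons in auto)
  then show ?case by simp
qed (simp add: assms(3))

text \<open>A function without \<sigma> does not see the system for \<sigma>. This connects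
  \<open>solution_set\<close> and self-adjointness, both stated with local differentiations, to the
  divergence, which uses the nonlocal ones.\<close>

lemma total_diff_local:
  fixes f :: "('n, 'd::finite, 'k) jet \<Rightarrow> real"
  assumes "open \<Omega>" "finite K" "differential_function \<Omega> (- range Nonloc) f" "z \<in> \<Omega>"
  shows "total_diff K G i f z = total_diff {} no_system i f z"
proof -
  obtain W where W: "finite W" "W \<subseteq> - range Nonloc" "determined_by \<Omega> W f"
    using differential_function_determined_by[OF assms(3)] .
  note sd = differential_function_separately_differentiable[OF assms(1,3)]
  have "total_coeff K G i v z = total_coeff {} no_system i v z" if "v \<in> W" for v
    using that W(2) by (cases v) (auto simp: total_coeff_def)
  then show ?thesis
    using total_diff_eq_sum[OF assms(1) sd W(1,3) assms(4,2)]
      total_diff_eq_sum[OF assms(1) sd W(1,3) assms(4) finite.emptyI] by simp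
qed

lemma total_diffs_local:
  fixes f :: "('n, 'd::finite, 'k) jet \<Rightarrow> real"
  assumes "open \<Omega>" "finite K" "differential_function \<Omega> (- range Nonloc) f" "z \<in> \<Omega>"
  shows "total_diffs K G l f z = total_diffs {} no_system l f z"
  using assms(4)
proof (induction l arbitrary: z)
  case (Cons i l)
  have "total_diff K G i (total_diffs K G l f) z = total_diff K G i (total_diffs {} no_system l f) z"
    by (rule total_diff_cong_open[OF assms(1) Cons.prems Cons.IH])
  also have "\<dots> = total_diff {} no_system i (total_diffs {} no_system l f) z"
    by (rule total_diff_local[OF assms(1,2) differential_function_total_diffs[OF assms(1) _ assms(3)] Cons.prems]) auto
  finally show ?case by simp
qed simp

text \<open>D_i D_j(f) splits into a second-order part, symmetric because partial derivatives
  commute, and a first-order part with coefficients D_i D_j of a coordinate, symmetric because both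
  orders add \<open>i\<close> and \<open>j\<close> to the same multiset. A nonlocal variable would
  contribute D_i(G_j), whose symmetry is assumed on solutions only; hence the restriction to local
  differentiations.\<close>

lemma total_diff_commute:
  fixes f :: "('n, 'd::finite, 'k) jet \<Rightarrow> real"
  assumes "open \<Omega>" "differential_function \<Omega> V f" "z \<in> \<Omega>"
  shows "total_diff {} no_system i (total_diff {} no_system j f) z =
    total_diff {} no_system j (total_diff {} no_system i f) z"
proof -
  let ?D = "total_diff {} (no_system :: 'k \<Rightarrow> 'n \<Rightarrow> ('n, 'd, 'k) jet \<Rightarrow> real)"
  let ?c = "total_coeff {} (no_system :: 'k \<Rightarrow> 'n \<Rightarrow> ('n, 'd, 'k) jet \<Rightarrow> real)"
  obtain W where W: "finite W" "W \<subseteq> V" "determined_by \<Omega> W f"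
    using differential_function_determined_by[OF assms(2)] .
  note sd = differential_function_separately_differentiable[OF assms(1)]
  note dfp = differential_function_partial[OF assms(1,2)]
  note fd = differential_function_finitely_differentiable[OF assms(1)]
  have fc: "finitely_differentiable \<Omega> (?c j v)" for j v
    by (cases v) (simp_all add: total_coeff_def[abs_def])
  have D: "?D i (?D j f) z = (\<Sum>v\<in>W. \<Sum>w\<in>W. ?c j v z * (?c i w z * partial w (partial v f) z))
      + (\<Sum>v\<in>W. ?D i (?c j v) z * partial v f z)" for i j
  proof -
    have "?D i (?D j f) z = ?D i (\<lambda>z. \<Sum>v\<in>W. ?c j v z * partial v f z) z"
      using assms(1,3) by (rule total_diff_cong_open)
        (rule total_diff_eq_sum[OF assms(1) sd[OF assms(2)] W(1,3) _ finite.emptyI])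
    also have "\<dots> = (\<Sum>v\<in>W. ?D i (\<lambda>z. ?c j v z * partial v f z) z)"
      by (intro total_diff_sum[OF assms(1)] finitely_differentiable_mult fc fd[OF dfp] assms(3)) simp
    also have "\<dots> = (\<Sum>v\<in>W. ?c j v z * ?D i (partial v f) z + ?D i (?c j v) z * partial v f z)"
      by (intro sum.cong refl total_diff_mult[OF assms(1)] fc fd[OF dfp] assms(3)) simp
    also have "\<dots> = (\<Sum>v\<in>W. ?c j v z * (\<Sum>w\<in>W. ?c i w z * partial w (partial v f) z)
        + ?D i (?c j v) z * partial v f z)"
      using total_diff_eq_sum[OF assms(1) sd[OF dfp] W(1)
          determined_by_partial[OF assms(1) W(3)] assms(3) finite.emptyI] by simp
    finally show ?thesis by (simp add: sum.distrib sum_distrib_left)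
  qed
  have coeff: "?D i (?c j v) z = ?D j (?c i v) z" for v
    by (cases v) (simp_all add: total_coeff_def[abs_def] total_diff_coord
        total_coeff_def add_mset_commute)
  have "(\<Sum>v\<in>W. \<Sum>w\<in>W. ?c j v z * (?c i w z * partial w (partial v f) z))
      = (\<Sum>w\<in>W. \<Sum>v\<in>W. ?c i w z * (?c j v z * partial v (partial w f) z))"
    by (subst sum.swap, intro sum.cong refl)
      (simp add: differential_function_partial_commute[OF assms] mult_ac)
  then show ?thesis
    unfolding D coeff by simp
qed

text \<open>The head \<open>x\<close> of the first list occurs somewhere in \<open>l'\<close>;
  \<open>move\<close> pulls it to the front past the entries before it, and induction treats the
  rest.\<close>

lemma total_diffs_mset:
  fixes f :: "('n, 'd::finite, 'k) jet \<Rightarrow> real"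
  assumes "open \<Omega>" "differential_function \<Omega> V f" "mset l = mset l'" "z \<in> \<Omega>"
  shows "total_diffs {} no_system l f z = total_diffs {} no_system l' f z"
  using assms(3,4)
proof (induction l arbitrary: l' z)
  case (Cons x l)
  let ?D = "total_diff {} (no_system :: 'k \<Rightarrow> 'n \<Rightarrow> ('n, 'd, 'k) jet \<Rightarrow> real)"
  let ?DD = "total_diffs {} (no_system :: 'k \<Rightarrow> 'n \<Rightarrow> ('n, 'd, 'k) jet \<Rightarrow> real)"
  have df: "differential_function \<Omega> UNIV (?DD k f)" for k
    by (intro differential_function_total_diffs[OF assms(1)] differential_function_mono[OF assms(2)]) auto
  have "x \<in> set l'"
    using Cons.prems(1) by (metis list.set_intros(1) set_mset_mset)
  then obtain a b where l': "l' = a @ x # b" by (meson split_list)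
  have move: "?D x (?DD (a @ b) f) z = ?DD (a @ x # b) f z" if "z \<in> \<Omega>" for z
    using that
  proof (induction a arbitrary: z)
    case (Cons y a)
    have "?D x (?D y (?DD (a @ b) f)) z = ?D y (?D x (?DD (a @ b) f)) z"
      by (rule total_diff_commute[OF assms(1) df Cons.prems])
    also have "\<dots> = ?D y (?DD (a @ x # b) f) z"
      by (rule total_diff_cong_open[OF assms(1) Cons.prems Cons.IH])
    finally show ?case by simp
  qed simp
  have "mset l = mset (a @ b)" using Cons.prems(1) l' by simp
  then have "?D x (?DD l f) z = ?D x (?DD (a @ b) f) z"
    using assms(1) Cons.prems(2) by (intro total_diff_cong_open Cons.IH)
  then show ?case using move[OF Cons.prems(2)] l' by simp
qed simp

section \<open>Elimination of the auxiliary variables\<close>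

text \<open>Inclusion of the original coordinates among those with v adjoined;
  \<open>forget_v\<close> is composition with it.\<close>

definition lift_var :: "('n, 'd, 'j, 'k) jet_var \<Rightarrow> ('n, 'd + 'b, 'j, 'k) jet_var" where
  "lift_var v = (case v of Indep i \<Rightarrow> Indep i | Dep \<alpha> J \<Rightarrow> Dep (Inl \<alpha>) J | Nonloc a \<Rightarrow> Nonloc a)"

lemma lift_var_simps [simp]:
  "lift_var (Indep i) = Indep i" "lift_var (Dep \<alpha> J) = Dep (Inl \<alpha>) J"
  "lift_var (Nonloc a) = Nonloc a"
  by (simp_all add: lift_var_def)

lemma inj_lift_var: "inj lift_var"
  by (rule injI) (auto simp: lift_var_def split: jet_var.splits)

lemma forget_v_eq: "forget_v y v = y (lift_var v)"
  by (cases v) (simp_all add: forget_v_def)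

lemma forget_v_upd: "forget_v (y(lift_var v := t)) = (forget_v y)(v := t)"
  by (rule ext) (simp add: forget_v_eq inj_eq[OF inj_lift_var])

lemma forget_v_upd_v: "forget_v (y(Dep (Inr b) J := t)) = forget_v y"
proof (rule ext)
  fix v show "forget_v (y(Dep (Inr b) J := t)) v = forget_v y v"
    by (cases v) (simp_all add: forget_v_eq)
qed

lemma jet_var_lift_cases:
  obtains v' where "v = lift_var v'" | b J where "v = Dep (Inr b) J"
proof (cases v)
  case (Indep i)
  then show thesis using that(1)[of "Indep i"] by simp
next
  case (Dep d J)
  then show thesis using that(1)[of "Dep _ J"] that(2) by (cases d) auto
next
  case (Nonloc a)
  then show thesis using that(1)[of "Nonloc a"] by simp
qed

lemma open_forget_v:
  fixes \<Omega> :: "('n, 'm, 'k) jet set"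
  assumes "open \<Omega>"
  shows "open (forget_v -` \<Omega> :: ('n, 'm + 'b, 'k) jet set)"
proof (rule open_vimage[OF assms], rule continuous_on_coordinatewise_then_product)
  fix v :: "('n, 'm, 'n multiset, 'k) jet_var"
  show "continuous_on UNIV (\<lambda>y :: ('n, 'm + 'b, 'k) jet. forget_v y v)"
    unfolding forget_v_eq by (rule continuous_on_product_then_coordinatewise[OF continuous_on_id])
qed

lemma partial_forget_v:
  "partial (lift_var v) (\<lambda>y. f (forget_v y)) y = partial v f (forget_v y)"
  by (simp add: partial_def forget_v_upd forget_v_eq)

lemma separately_differentiable_forget_v:
  fixes \<Omega> :: "('n, 'm, 'k) jet set"
  assumes "separately_differentiable \<Omega> f"
  shows "separately_differentiable (forget_v -` \<Omega> :: ('n, 'm + 'b, 'k) jet set) (\<lambda>y. f (forget_v y))"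
  unfolding separately_differentiable_def
proof (intro ballI allI)
  fix y :: "('n, 'm + 'b, 'k) jet" and v assume "y \<in> forget_v -` \<Omega>"
  then have y: "forget_v y \<in> \<Omega>" by simp
  show "(\<lambda>t. f (forget_v (y(v := t)))) field_differentiable at (y v)"
  proof (cases v rule: jet_var_lift_cases)
    case (1 v')
    then show ?thesis
      using separately_differentiableD[OF assms y, of v'] by (simp add: forget_v_upd forget_v_eq)
  next
    case (2 b J)
    then show ?thesis by (simp add: forget_v_upd_v field_differentiable_const)
  qed
qed

lemma determined_by_forget_v:
  assumes "determined_by \<Omega> W f"
  shows "determined_by (forget_v -` \<Omega>) (lift_var ` W) (\<lambda>y. f (forget_v y))"
  unfolding determined_by_def
proof (intro ballI impI)
  fix y z assume yz: "y \<in> forget_v -` \<Omega>" "z \<in> forget_v -` \<Omega>" "\<forall>v\<in>lift_var ` W. y v = z v"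
  then have "\<forall>v\<in>W. forget_v y v = forget_v z v"
    by (simp add: forget_v_eq)
  moreover have "forget_v y \<in> \<Omega>" "forget_v z \<in> \<Omega>"
    using yz by simp_all
  ultimately show "f (forget_v y) = f (forget_v z)"
    using assms unfolding determined_by_def by blast
qed

lemma finitely_differentiable_forget_v:
  assumes "finitely_differentiable \<Omega> f"
  shows "finitely_differentiable (forget_v -` \<Omega>) (\<lambda>y. f (forget_v y))"
proof -
  from assms obtain W where "separately_differentiable \<Omega> f" "finite W" "determined_by \<Omega> W f"
    unfolding finitely_differentiable_def by blast
  then show ?thesis
    unfolding finitely_differentiable_def
    by (intro conjI exI[of _ "lift_var ` W"] separately_differentiable_forget_v
        determined_by_forget_v finite_imageI)
qed

text \<open>D_i on the larger jet space extends D_i on the smaller one. Agreement of coefficients is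
  asked for on \<open>W\<close> only, which covers both a local \<open>f\<close>, with unrelated
  systems on the two sides, and a nonlocal one with the system pulled back.\<close>

lemma total_diff_forget_v:
  fixes y :: "('n, 'm::finite + 'b::finite, 'k) jet"
  assumes "open \<Omega>" "separately_differentiable \<Omega> f" "finite W" "determined_by \<Omega> W f"
    and "forget_v y \<in> \<Omega>" "finite K" "finite K'"
    and "\<And>v. v \<in> W \<Longrightarrow> total_coeff K' G' i (lift_var v) y = total_coeff K G i v (forget_v y)"
  shows "total_diff K' G' i (\<lambda>y. f (forget_v y)) y = total_diff K G i f (forget_v y)"
proof -
  have "total_diff K' G' i (\<lambda>y. f (forget_v y)) y =
      (\<Sum>v\<in>lift_var ` W. total_coeff K' G' i v y * partial v (\<lambda>y. f (forget_v y)) y)"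
    using assms(3,5,7)
    by (intro total_diff_eq_sum[OF open_forget_v[OF assms(1)]
          separately_differentiable_forget_v[OF assms(2)] _ determined_by_forget_v[OF assms(4)]]) auto
  also have "\<dots> = (\<Sum>v\<in>W. total_coeff K G i v (forget_v y) * partial v f (forget_v y))"
    using assms(8)
    by (subst sum.reindex) (auto intro: inj_on_subset[OF inj_lift_var] simp: partial_forget_v)
  also have "\<dots> = total_diff K G i f (forget_v y)"
    using total_diff_eq_sum[OF assms(1-6)] by simp
  finally show ?thesis .
qed

lemma total_diff_forget_v_local:
  fixes y :: "('n, 'm::finite + 'b::finite, 'k) jet"
  assumes "open \<Omega>" "differential_function \<Omega> (- range Nonloc) f" "forget_v y \<in> \<Omega>" "finite K"
  shows "total_diff K G i (\<lambda>y. f (forget_v y)) y = total_diff {} no_system i f (forget_v y)"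
proof -
  obtain W where W: "finite W" "W \<subseteq> - range Nonloc" "determined_by \<Omega> W f"
    using differential_function_determined_by[OF assms(2)] .
  have "total_coeff K G i (lift_var v) y = total_coeff {} no_system i v (forget_v y)" if "v \<in> W" for v
    using that W(2) by (cases v) (auto simp: total_coeff_def forget_v_eq)
  from total_diff_forget_v[OF assms(1) differential_function_separately_differentiable[OF assms(1,2)]
      W(1,3) assms(3) finite.emptyI assms(4) this]
  show ?thesis .
qed

lemma total_diffs_forget_v:
  fixes y :: "('n, 'm::finite + 'b::finite, 'k) jet"
  assumes "open \<Omega>" "finite K" "differential_function \<Omega> UNIV f" "forget_v y \<in> \<Omega>"
    and G: "\<And>a i. a \<in> K \<Longrightarrow> differential_function \<Omega> UNIV (G a i)"
  shows "total_diffs K (\<lambda>a j. G a j \<circ> forget_v) l (f \<circ> forget_v) y = total_diffs K G l f (forget_v y)"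
  using assms(4)
proof (induction l arbitrary: y)
  case (Cons i l)
  let ?G = "\<lambda>a j. G a j \<circ> forget_v :: ('n, 'm + 'b, 'k) jet \<Rightarrow> real"
  have df: "differential_function \<Omega> UNIV (total_diffs K G l f)"
    by (rule differential_function_total_diffs[OF assms(1-3)]) (auto intro: G)
  obtain W where W: "finite W" "determined_by \<Omega> W (total_diffs K G l f)"
    using differential_function_determined_by[OF df] .
  have coeff: "total_coeff K ?G i (lift_var v) y = total_coeff K G i v (forget_v y)" for v
    by (cases v) (simp_all add: total_coeff_def forget_v_eq)
  have "total_diff K ?G i (total_diffs K ?G l (f \<circ> forget_v)) y =
      total_diff K ?G i (\<lambda>y. total_diffs K G l f (forget_v y)) y"
    using Cons.prems by (intro total_diff_cong_open[OF open_forget_v[OF assms(1)]] Cons.IH)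
      (simp_all only: vimage_eq)
  also have "\<dots> = total_diff K G i (total_diffs K G l f) (forget_v y)"
    by (rule total_diff_forget_v[OF assms(1)
          differential_function_separately_differentiable[OF assms(1) df] W Cons.prems assms(2,2) coeff])
  finally show ?case
    by (simp only: foldr.simps comp_def[of "total_diff K G i"] comp_def[of "total_diff K ?G i"])
qed simp

section \<open>Substitution of \<phi> for v\<close>

lemma forget_v_substitute_v [simp]: "forget_v (substitute_v \<phi> z) = z"
proof (rule ext)
  fix v show "forget_v (substitute_v \<phi> z) v = z v"
    by (cases v) (simp_all add: forget_v_def substitute_v_def)
qed

lemma substitute_v_Inr:
  "substitute_v \<phi> z (Dep (Inr b) J) = total_diffs {} no_system (SOME l. mset l = J) (\<phi> b) z"
  by (simp add: substitute_v_def)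

text \<open>
  Pairs of a function \<open>h\<close> linear in the \<open>v\<^sub>J\<close> and its restriction \<open>h\<^sub>0\<close> to \<open>v = \<phi>\<close>.  As all functions that
  involve \<open>v\<close> here are of this form, the Leibniz rule replaces the chain rule for the substitution.
\<close>

inductive linear_in_v ::
  "('n, 'm::finite, 'k) jet set \<Rightarrow> ('b::finite \<Rightarrow> ('n, 'm, 'k) jet \<Rightarrow> real)
    \<Rightarrow> (('n, 'm + 'b, 'k) jet \<Rightarrow> real) \<Rightarrow> (('n, 'm, 'k) jet \<Rightarrow> real) \<Rightarrow> bool" for \<Omega> \<phi> where
  zero: "linear_in_v \<Omega> \<phi> (\<lambda>y. 0) (\<lambda>z. 0)"
| add: "linear_in_v \<Omega> \<phi> h h\<^sub>0 \<Longrightarrow> differential_function \<Omega> (- range Nonloc) g \<Longrightarrow>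
    linear_in_v \<Omega> \<phi> (\<lambda>y. y (Dep (Inr b) J) * g (forget_v y) + h y)
      (\<lambda>z. total_diffs {} no_system (SOME l. mset l = J) (\<phi> b) z * g z + h\<^sub>0 z)"

lemma linear_in_v_substitute:
  assumes "linear_in_v \<Omega> \<phi> h h\<^sub>0"
  shows "h (substitute_v \<phi> z) = h\<^sub>0 z"
  using assms by induction (simp_all add: substitute_v_Inr)

lemma linear_in_v_finitely_differentiable:
  assumes "open \<Omega>" "linear_in_v \<Omega> \<phi> h h\<^sub>0"
  shows "finitely_differentiable (forget_v -` \<Omega>) h"
  using assms(2)
  by induction (auto intro!: finitely_differentiable_add finitely_differentiable_mult
      finitely_differentiable_forget_v differential_function_finitely_differentiable[OF assms(1)])

context
  fixes \<Omega> :: "('n, 'm::finite, 'k) jet set" and \<phi> :: "'b::finite \<Rightarrow> ('n, 'm, 'k) jet \<Rightarrow> real"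
  assumes open_\<Omega>: "open \<Omega>" and \<phi>: "\<And>b. differential_function \<Omega> (- range Nonloc) (\<phi> b)"
begin

lemma differential_function_total_diffs_local:
  "differential_function \<Omega> (- range Nonloc) f \<Longrightarrow>
    differential_function \<Omega> (- range Nonloc) (total_diffs {} no_system l f)"
  by (rule differential_function_total_diffs[OF open_\<Omega>]) auto

lemma linear_in_v_differential_function:
  assumes "linear_in_v \<Omega> \<phi> h h\<^sub>0"
  shows "differential_function \<Omega> (- range Nonloc) h\<^sub>0"
  using assms
  by induction (auto intro!: differential_function.const differential_function.add
      differential_function.mult differential_function_total_diffs_local \<phi>)

text \<open>The derivative of v_J g is v_J D_i(g) + v_(J+i) g, again in the class, and its
  restriction follows the same rule with D_J(\<phi>) for v_J. The first identity is stated at every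
  \<open>y\<close> over \<open>\<Omega>\<close>, not only at substituted points, since it is
  differentiated again.\<close>

lemma linear_in_v_total_diff:
  fixes G :: "'k \<Rightarrow> 'n \<Rightarrow> ('n, 'm + 'b, 'k) jet \<Rightarrow> real"
  assumes "linear_in_v \<Omega> \<phi> h h\<^sub>0" "finite K"
  shows "\<exists>h' h\<^sub>0'. linear_in_v \<Omega> \<phi> h' h\<^sub>0' \<and>
    (\<forall>y\<in>forget_v -` \<Omega>. total_diff K G i h y = h' y) \<and>
    (\<forall>z\<in>\<Omega>. total_diff {} no_system i h\<^sub>0 z = h\<^sub>0' z)"
  using assms(1)
proof induction
  case zero
  show ?case using linear_in_v.zero by (intro exI[of _ "\<lambda>_. 0"]) simp
next
  case (add h h\<^sub>0 g b J)
  let ?D = "total_diff {} no_system i :: (('n, 'm, 'k) jet \<Rightarrow> real) \<Rightarrow> _"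
  let ?v = "\<lambda>J. total_diffs {} no_system (SOME l. mset l = J) (\<phi> b)"
  let ?g = "\<lambda>y. g (forget_v y)"
  from add.IH obtain h' h\<^sub>0' where IH: "linear_in_v \<Omega> \<phi> h' h\<^sub>0'"
    "\<And>y. forget_v y \<in> \<Omega> \<Longrightarrow> total_diff K G i h y = h' y"
    "\<And>z. z \<in> \<Omega> \<Longrightarrow> ?D h\<^sub>0 z = h\<^sub>0' z" by auto
  note fd = differential_function_finitely_differentiable[OF open_\<Omega>]
  have dfg: "differential_function \<Omega> (- range Nonloc) (?D g)"
    using differential_function_total_diffs_local[OF add.hyps(2), of "[i]"] by simp
  have "total_diff K G i (\<lambda>y. y (Dep (Inr b) J) * ?g y + h y) y =
      y (Dep (Inr b) J) * ?D g (forget_v y) + (y (Dep (Inr b) (add_mset i J)) * ?g y + h' y)"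
    if "forget_v y \<in> \<Omega>" for y :: "('n, 'm + 'b, 'k) jet"
  proof -
    note op = open_forget_v[OF open_\<Omega>]
    have y: "y \<in> forget_v -` \<Omega>" using that by simp
    note fdg = finitely_differentiable_forget_v[OF fd[OF add.hyps(2)]]
    have "total_diff K G i (\<lambda>y. y (Dep (Inr b) J) * ?g y + h y) y =
        total_diff K G i (\<lambda>y. y (Dep (Inr b) J) * ?g y) y + total_diff K G i h y"
      by (rule total_diff_add[OF op assms(2) finitely_differentiable_mult
            linear_in_v_finitely_differentiable[OF open_\<Omega> add.hyps(1)] y]) (simp_all add: fdg)
    also have "total_diff K G i (\<lambda>y. y (Dep (Inr b) J) * ?g y) y =
        y (Dep (Inr b) J) * total_diff K G i ?g y + total_diff K G i (\<lambda>y. y (Dep (Inr b) J)) y * ?g y"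
      by (rule total_diff_mult[OF op assms(2) _ fdg y]) simp
    finally show ?thesis
      using IH(2) that
      by (simp add: total_diff_forget_v_local[OF open_\<Omega> add.hyps(2) that assms(2)]
          total_diff_coord[OF assms(2)] total_coeff_def)
  qed
  moreover have "?D (\<lambda>z. ?v J z * g z + h\<^sub>0 z) z =
      ?v J z * ?D g z + (?v (add_mset i J) z * g z + h\<^sub>0' z)" if z: "z \<in> \<Omega>" for z
  proof -
    have dfv: "differential_function \<Omega> (- range Nonloc) (?v J)"
      by (rule differential_function_total_diffs_local[OF \<phi>])
    have "?D (\<lambda>z. ?v J z * g z + h\<^sub>0 z) z = ?D (\<lambda>z. ?v J z * g z) z + ?D h\<^sub>0 z"
      by (rule total_diff_add[OF open_\<Omega> finite.emptyI fd[OF differential_function.mult[OF dfv add.hyps(2)]]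
            fd[OF linear_in_v_differential_function[OF add.hyps(1)]] z])
    also have "?D (\<lambda>z. ?v J z * g z) z = ?v J z * ?D g z + ?D (?v J) z * g z"
      by (rule total_diff_mult[OF open_\<Omega> finite.emptyI fd[OF dfv] fd[OF add.hyps(2)] z])
    \<comment> \<open>The ordering chosen for the larger multiset need not be \<open>i\<close>
      followed by the one chosen for \<open>J\<close>, hence the appeal to commutation through
      \<open>total_diffs_mset\<close>.\<close>
    also have "?D (?v J) z = ?v (add_mset i J) z"
    proof -
      have some: "mset (SOME l. mset l = M) = M" for M :: "'n multiset"
        by (rule someI_ex) (rule ex_mset)
      have "?D (?v J) z = total_diffs {} no_system (i # (SOME l. mset l = J)) (\<phi> b) z"
        by simp
      also have "\<dots> = ?v (add_mset i J) z"
        by (rule total_diffs_mset[OF open_\<Omega> \<phi> _ z]) (simp add: some)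
      finally show ?thesis .
    qed
    finally show ?thesis using IH(3)[OF z] by simp
  qed
  ultimately show ?case
    using linear_in_v.add[OF linear_in_v.add[OF IH(1) add.hyps(2), of b "add_mset i J"] dfg, of b J]
    by (intro exI conjI) auto
qed

lemma linear_in_v_total_diffs:
  fixes G :: "'k \<Rightarrow> 'n \<Rightarrow> ('n, 'm + 'b, 'k) jet \<Rightarrow> real"
  assumes "linear_in_v \<Omega> \<phi> h h\<^sub>0" "finite K"
  shows "\<exists>h' h\<^sub>0'. linear_in_v \<Omega> \<phi> h' h\<^sub>0' \<and>
    (\<forall>y\<in>forget_v -` \<Omega>. total_diffs K G l h y = h' y) \<and>
    (\<forall>z\<in>\<Omega>. total_diffs {} no_system l h\<^sub>0 z = h\<^sub>0' z)"
proof (induction l)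
  case Nil
  show ?case using assms(1) by auto
next
  case (Cons i l)
  then obtain h' h\<^sub>0' where 1: "linear_in_v \<Omega> \<phi> h' h\<^sub>0'"
    "\<And>y. y \<in> forget_v -` \<Omega> \<Longrightarrow> total_diffs K G l h y = h' y"
    "\<And>z. z \<in> \<Omega> \<Longrightarrow> total_diffs {} no_system l h\<^sub>0 z = h\<^sub>0' z" by blast
  from linear_in_v_total_diff[OF 1(1) assms(2)] obtain h'' h\<^sub>0'' where
    2: "linear_in_v \<Omega> \<phi> h'' h\<^sub>0''"
    "\<And>y. y \<in> forget_v -` \<Omega> \<Longrightarrow> total_diff K G i h' y = h'' y"
    "\<And>z. z \<in> \<Omega> \<Longrightarrow> total_diff {} no_system i h\<^sub>0' z = h\<^sub>0'' z" by blast
  have "total_diffs K G (i # l) h y = h'' y" if "y \<in> forget_v -` \<Omega>" for y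
    using total_diff_cong_open[OF open_forget_v[OF open_\<Omega>] that 1(2)] 2(2)[OF that] by simp
  moreover have "total_diffs {} no_system (i # l) h\<^sub>0 z = h\<^sub>0'' z" if "z \<in> \<Omega>" for z
    using total_diff_cong_open[OF open_\<Omega> that 1(3)] 2(3)[OF that] by simp
  ultimately show ?case using 2(1) by blast
qed

text \<open>The purpose of \<open>linear_in_v\<close>: differentiating on the large jet space and
  then restricting agrees with restricting and then differentiating. As the functions are local, any
  system for \<sigma> may stand on the left.\<close>

lemma linear_in_v_total_diffs_substitute:
  fixes G :: "'k \<Rightarrow> 'n \<Rightarrow> ('n, 'm + 'b, 'k) jet \<Rightarrow> real"
  assumes "linear_in_v \<Omega> \<phi> h h\<^sub>0" "finite K" "z \<in> \<Omega>"
  shows "total_diffs K G l h (substitute_v \<phi> z) = total_diffs {} no_system l h\<^sub>0 z"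
proof -
  from linear_in_v_total_diffs[OF assms(1,2)] obtain h' h\<^sub>0' where
    "linear_in_v \<Omega> \<phi> h' h\<^sub>0'"
    "\<And>y. y \<in> forget_v -` \<Omega> \<Longrightarrow> total_diffs K G l h y = h' y"
    "\<And>z. z \<in> \<Omega> \<Longrightarrow> total_diffs {} no_system l h\<^sub>0 z = h\<^sub>0' z" by blast
  then show ?thesis using linear_in_v_substitute assms(3) by fastforce
qed

lemma linear_in_v_sum:
  assumes "\<And>b. differential_function \<Omega> (- range Nonloc) (g b)"
  shows "linear_in_v \<Omega> \<phi> (\<lambda>y. \<Sum>b\<in>B. y (Dep (Inr b) {#}) * g b (forget_v y)) (\<lambda>z. \<Sum>b\<in>B. \<phi> b z * g b z)"
proof (induction B rule: infinite_finite_induct)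
  case (insert b B)
  from linear_in_v.add[OF insert.IH assms, of b "{#}"] insert.hyps show ?case by simp
qed (simp_all add: linear_in_v.zero)

end

text \<open>The variables v are independent of u, so the derivative acts on the factors
  \<open>F b\<close> alone. The result has the form treated by
  \<open>linear_in_v_sum\<close>.\<close>

lemma dpartial_formal_lagrangian:
  fixes F :: "'b::finite \<Rightarrow> ('n, 'm::finite, 'k) jet \<Rightarrow> real"
  assumes "open \<Omega>" "\<And>b. separately_differentiable \<Omega> (F b)" "forget_v y \<in> \<Omega>"
  shows "dpartial (Inl \<alpha>) l (formal_lagrangian F) y =
    (\<Sum>b\<in>UNIV. y (Dep (Inr b) {#}) * dpartial \<alpha> l (F b) (forget_v y))"
proof -
  let ?\<Omega> = "forget_v -` \<Omega> :: ('n, 'm + 'b, 'k) jet set"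
  let ?t = "\<lambda>b y. y (Dep (Inr b) {#}) * F b (forget_v y) :: real"
  let ?v = "Dep (Inl \<alpha>) (mset l) :: ('n, 'm + 'b, 'n multiset, 'k) jet_var"
  have y: "y \<in> ?\<Omega>" using assms(3) by simp
  have sd: "separately_differentiable ?\<Omega> (?t b)" for b
    by (intro separately_differentiable_mult separately_differentiable_forget_v
        separately_differentiable_coord assms(2))
  have sum: "separately_differentiable ?\<Omega> (\<lambda>y. \<Sum>b\<in>B. ?t b y) \<and>
      partial ?v (\<lambda>y. \<Sum>b\<in>B. ?t b y) y = (\<Sum>b\<in>B. partial ?v (?t b) y)" for B
  proof (induction B rule: infinite_finite_induct)
    case (insert b B)
    then show ?case
      using separately_differentiable_add[OF sd, of _ b] partial_add[OF sd _ y, of _ ?v b] by simp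
  qed simp_all
  have "partial ?v (?t b) y = y (Dep (Inr b) {#}) * partial (Dep \<alpha> (mset l)) (F b) (forget_v y)" for b
    using partial_mult[OF separately_differentiable_coord
        separately_differentiable_forget_v[OF assms(2)] y, of ?v]
      partial_forget_v[of "Dep \<alpha> (mset l)" "F b" y]
    by (simp add: partial_coord)
  then have "partial ?v (formal_lagrangian F) y =
      (\<Sum>b\<in>UNIV. y (Dep (Inr b) {#}) * partial (Dep \<alpha> (mset l)) (F b) (forget_v y))"
    using sum[of UNIV] unfolding formal_lagrangian_def[abs_def] by simp
  moreover have "separately_differentiable ?\<Omega> (formal_lagrangian F)"
    using sum[of UNIV] unfolding formal_lagrangian_def[abs_def] by simp
  from separately_differentiableD[OF this y]
  have "dpartial (Inl \<alpha>) l (formal_lagrangian F) y =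
      partial ?v (formal_lagrangian F) y / real (card (permutations_of_multiset (mset l)))"
    by (rule dpartial_eq_partial)
  moreover have "dpartial \<alpha> l (F b) (forget_v y) =
      partial (Dep \<alpha> (mset l)) (F b) (forget_v y) / real (card (permutations_of_multiset (mset l)))" for b
    using separately_differentiableD[OF assms(2,3)] by (rule dpartial_eq_partial)
  ultimately show ?thesis
    by (simp add: sum_divide_distrib)
qed

section \<open>The divergence of the conserved vector\<close>

lemma finite_length_le: "finite {k :: 'n::finite list. length k \<le> N}"
  using finite_lists_length_le[of "UNIV :: 'n set" N] by simp

text \<open>A nonempty tuple is a first index followed by a shorter tuple. This is the reindexing
  behind the telescoping: a sum over \<open>i\<close> and \<open>k\<close> of terms at
  \<open>i # k\<close> lacks only the empty tuple.\<close>

lemma sum_length_le_Suc: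
  fixes g :: "'n::finite list \<Rightarrow> real"
  shows "(\<Sum>k | length k \<le> Suc N. g k) = g [] + (\<Sum>i\<in>UNIV. \<Sum>k | length k \<le> N. g (i # k))"
proof -
  let ?A = "(UNIV :: 'n set) \<times> {k. length k \<le> N}"
  have eq: "{k. length k \<le> Suc N} = insert [] ((\<lambda>(i, k). i # k) ` ?A)"
  proof (intro set_eqI iffI)
    fix k :: "'n list" assume "k \<in> {k. length k \<le> Suc N}"
    then show "k \<in> insert [] ((\<lambda>(i, k). i # k) ` ?A)"
      by (cases k) (auto simp: image_iff)
  qed auto
  have "(\<Sum>k | length k \<le> Suc N. g k) = g [] + sum g ((\<lambda>(i, k). i # k) ` ?A)"
    unfolding eq by (rule sum.insert) (auto simp: finite_length_le)
  also have "sum g ((\<lambda>(i, k). i # k) ` ?A) = (\<Sum>i\<in>UNIV. \<Sum>k | length k \<le> N. g (i # k))"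
    by (subst sum.reindex) (auto simp: inj_on_def sum.cartesian_product intro!: sum.cong)
  finally show ?thesis .
qed

lemma sum_length_le_extend:
  fixes g :: "'n::finite list \<Rightarrow> real"
  assumes "\<And>k. length k > N \<Longrightarrow> g k = 0"
  shows "(\<Sum>k | length k \<le> Suc N. g k) = (\<Sum>k | length k \<le> N. g k)"
  using assms by (intro sum.mono_neutral_right) (auto simp: finite_length_le)

lemma Sum_any_length_le:
  fixes g :: "'n::finite list \<Rightarrow> real"
  assumes "\<And>k. length k > N \<Longrightarrow> g k = 0"
  shows "Sum_any g = (\<Sum>k | length k \<le> N. g k)"
proof (rule Sum_any.expand_superset)
  show "{k. g k \<noteq> 0} \<subseteq> {k. length k \<le> N}"
    using assms by (metis (mono_tags, lifting) Collect_mono not_le)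
qed (rule finite_length_le)

text \<open>Since \<open>P l\<close> vanishes on \<open>\<Omega>\<close> for tuples longer than
  \<open>s\<close>, the sums may be cut at \<open>s\<close> or at \<open>Suc s\<close> alike, and
  this absorbs the index gained from each D_i.\<close>

lemma summation_by_parts:
  fixes w :: "('n::finite, 'm::finite, 'k) jet \<Rightarrow> real" and P :: "'n list \<Rightarrow> ('n, 'm, 'k) jet \<Rightarrow> real"
  defines "E \<equiv> \<lambda>K G s l z. \<Sum>k | length k \<le> s. (- 1) ^ length k * total_diffs K G k (P (l @ k)) z"
  assumes "open \<Omega>" "finite K" and w: "differential_function \<Omega> UNIV w"
    and P: "\<And>l. differential_function \<Omega> UNIV (P l)"
    and G: "\<And>a i. a \<in> K \<Longrightarrow> differential_function \<Omega> UNIV (G a i)"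
    and P_mset: "\<And>l l'. mset l = mset l' \<Longrightarrow> P l = P l'"
    and P_zero: "\<And>l z. length l > s \<Longrightarrow> z \<in> \<Omega> \<Longrightarrow> P l z = 0"
    and z: "z \<in> \<Omega>"
  shows "(\<Sum>i\<in>UNIV. total_diff K G i
        (\<lambda>z. \<Sum>l | length l \<le> s. total_diffs K G l w z * E K G s (i # l) z) z)
    = (\<Sum>l | length l \<le> s. total_diffs K G l w z * P l z) - w z * E K G s [] z"
proof -
  let ?D = "total_diff K G" and ?DD = "total_diffs K G" and ?E = "E K G s"
  note fd = differential_function_finitely_differentiable[OF assms(2)]
  have df: "differential_function \<Omega> UNIV (?DD l f)" if "differential_function \<Omega> UNIV f" for l f
    by (rule differential_function_total_diffs[OF assms(2,3) that]) (auto intro: G)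
  have dfE: "differential_function \<Omega> UNIV (?E l)" for l
    unfolding E_def
    by (intro differential_function_sum differential_function.mult differential_function.const df P)
  \<comment> \<open>\<open>P l\<close> is zero on all of the open set, hence so are its total
    derivatives.\<close>
  have D_zero: "?DD k (P l) z = 0" if "length l > s" "z \<in> \<Omega>" for k l z
    using total_diffs_cong_open[OF assms(2) that(2) P_zero[OF that(1)]] by simp
  have E_zero: "?E l z = 0" if "length l > s" for l
    unfolding E_def using D_zero z that by (intro sum.neutral) simp
  have divE: "(\<Sum>i\<in>UNIV. ?D i (?E (i # l)) z) = P l z - ?E l z" for l
  proof -
    let ?g = "\<lambda>k. (- 1) ^ length k * ?DD k (P (l @ k)) z"
    have "?D i (?E (i # l)) z = (\<Sum>k | length k \<le> s. - ?g (i # k))" for i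
    proof -
      have "?D i (?E (i # l)) z =
          (\<Sum>k | length k \<le> s. ?D i (\<lambda>z. (- 1) ^ length k * ?DD k (P ((i # l) @ k)) z) z)"
        unfolding E_def
        by (intro total_diff_sum[OF assms(2,3) _ z] finitely_differentiable_mult fd[OF df[OF P]]) simp
      also have "\<dots> = (\<Sum>k | length k \<le> s. (- 1) ^ length k * ?DD (i # k) (P ((i # l) @ k)) z)"
        by (simp add: total_diff_cmult[OF assms(2,3) fd[OF df[OF P]] z])
      also have "\<dots> = (\<Sum>k | length k \<le> s. - ?g (i # k))"
      proof (rule sum.cong[OF refl])
        fix k
        \<comment> \<open>D_i stands outermost, so D_i D_k is the derivative along
          \<open>i # k\<close> as it stands. The index \<open>i\<close> passes \<open>l\<close> only
          inside \<open>P\<close>, which depends on the multiset alone; the longer tuple supplies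
          the minus sign.\<close>
        have "P ((i # l) @ k) = P (l @ i # k)" by (rule P_mset) simp
        then show "(- 1) ^ length k * ?DD (i # k) (P ((i # l) @ k)) z = - ?g (i # k)" by simp
      qed
      finally show ?thesis .
    qed
    then have "(\<Sum>i\<in>UNIV. ?D i (?E (i # l)) z) = - (\<Sum>i\<in>UNIV. \<Sum>k | length k \<le> s. ?g (i # k))"
      by (simp only: sum_negf)
    also have "\<dots> = ?g [] - (\<Sum>k | length k \<le> Suc s. ?g k)"
      unfolding sum_length_le_Suc by simp
    also have "(\<Sum>k | length k \<le> Suc s. ?g k) = ?E l z"
      unfolding E_def using D_zero z by (intro sum_length_le_extend) simp
    finally show ?thesis by simp
  qed
  have "?D i (\<lambda>z. \<Sum>l | length l \<le> s. ?DD l w z * ?E (i # l) z) z =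
      (\<Sum>l | length l \<le> s. ?DD l w z * ?D i (?E (i # l)) z + ?DD (i # l) w z * ?E (i # l) z)" for i
  proof -
    have "?D i (\<lambda>z. \<Sum>l | length l \<le> s. ?DD l w z * ?E (i # l) z) z =
        (\<Sum>l | length l \<le> s. ?D i (\<lambda>z. ?DD l w z * ?E (i # l) z) z)"
      by (intro total_diff_sum[OF assms(2,3) _ z] finitely_differentiable_mult fd[OF df[OF w]] fd[OF dfE])
    also have "\<dots> = (\<Sum>l | length l \<le> s. ?DD l w z * ?D i (?E (i # l)) z + ?DD (i # l) w z * ?E (i # l) z)"
      by (simp add: total_diff_mult[OF assms(2,3) fd[OF df[OF w]] fd[OF dfE] z])
    finally show ?thesis .
  qed
  then have "(\<Sum>i\<in>UNIV. ?D i (\<lambda>z. \<Sum>l | length l \<le> s. ?DD l w z * ?E (i # l) z) z) =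
      (\<Sum>i\<in>UNIV. \<Sum>l | length l \<le> s. ?DD l w z * ?D i (?E (i # l)) z)
      + (\<Sum>i\<in>UNIV. \<Sum>l | length l \<le> s. ?DD (i # l) w z * ?E (i # l) z)"
    by (simp only: sum.distrib)
  also have "(\<Sum>i\<in>UNIV. \<Sum>l | length l \<le> s. ?DD l w z * ?D i (?E (i # l)) z) =
      (\<Sum>l | length l \<le> s. ?DD l w z * (P l z - ?E l z))"
    unfolding divE[symmetric] sum_distrib_left by (rule sum.swap)
  \<comment> \<open>The tuples \<open>i # l\<close> are the nonempty ones; the term of the empty
    tuple is what has to be subtracted, and it becomes the Euler-Lagrange term.\<close>
  also have "(\<Sum>i\<in>UNIV. \<Sum>l | length l \<le> s. ?DD (i # l) w z * ?E (i # l) z) =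
      (\<Sum>l | length l \<le> Suc s. ?DD l w z * ?E l z) - w z * ?E [] z"
    unfolding sum_length_le_Suc by simp
  also have "(\<Sum>l | length l \<le> Suc s. ?DD l w z * ?E l z) = (\<Sum>l | length l \<le> s. ?DD l w z * ?E l z)"
    using E_zero by (intro sum_length_le_extend) simp
  finally show ?thesis
    by (simp add: right_diff_distrib sum_subtractf)
qed

section \<open>The prolonged field in terms of the characteristic\<close>

text \<open>For the empty tuple this is \<eta> = W + \<xi>^j u_j, so the case distinction in
  \<open>prolong_coeff\<close> disappears.\<close>

lemma prolong_coeff_eq:
  "prolong_coeff K G \<xi> \<eta> \<alpha> l z = total_diffs K G l (characteristic \<xi> \<eta> \<alpha>) z
    + (\<Sum>j\<in>UNIV. \<xi> j z * z (Dep \<alpha> (mset (j # l))))"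
  by (cases l) (simp_all add: prolong_coeff_def characteristic_def)

text \<open>The parts \<xi>^j u_jl of the coefficients join \<xi>^i d/dx^i to form \<xi>^i D_i. This
  D_i is the local one for any \<open>K\<close> and \<open>G\<close>, since the prolonged field has
  no component along \<sigma>; its value on \<open>F b\<close> is therefore a differential
  consequence of the system.\<close>

lemma prolonged_field_eq:
  fixes f :: "('n::finite, 'm::finite, 'k) jet \<Rightarrow> real"
  assumes "\<And>\<alpha> l. length l > s \<Longrightarrow> dpartial \<alpha> l f z = 0"
  shows "prolonged_field K G \<xi> \<eta> f z = (\<Sum>i\<in>UNIV. \<xi> i z * total_diff {} no_system i f z)
    + (\<Sum>\<alpha>\<in>UNIV. \<Sum>l | length l \<le> s. total_diffs K G l (characteristic \<xi> \<eta> \<alpha>) z * dpartial \<alpha> l f z)"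
proof -
  let ?W = "\<lambda>\<alpha> l. total_diffs K G l (characteristic \<xi> \<eta> \<alpha>) z"
  let ?u = "\<lambda>j \<alpha> l. z (Dep \<alpha> (mset (j # l))) * dpartial \<alpha> l f z"
  have "Sum_any (\<lambda>l. prolong_coeff K G \<xi> \<eta> \<alpha> l z * dpartial \<alpha> l f z) =
      (\<Sum>l | length l \<le> s. ?W \<alpha> l * dpartial \<alpha> l f z) + (\<Sum>j\<in>UNIV. \<xi> j z * (\<Sum>l | length l \<le> s. ?u j \<alpha> l))"
    for \<alpha>
  proof -
    have "Sum_any (\<lambda>l. prolong_coeff K G \<xi> \<eta> \<alpha> l z * dpartial \<alpha> l f z) =
        (\<Sum>l | length l \<le> s. prolong_coeff K G \<xi> \<eta> \<alpha> l z * dpartial \<alpha> l f z)"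
      using assms by (intro Sum_any_length_le) simp
    also have "\<dots> = (\<Sum>l | length l \<le> s. ?W \<alpha> l * dpartial \<alpha> l f z)
        + (\<Sum>l | length l \<le> s. \<Sum>j\<in>UNIV. \<xi> j z * ?u j \<alpha> l)"
      unfolding prolong_coeff_eq distrib_right sum.distrib sum_distrib_right
      by (simp only: mult.assoc)
    also have "(\<Sum>l | length l \<le> s. \<Sum>j\<in>UNIV. \<xi> j z * ?u j \<alpha> l) =
        (\<Sum>j\<in>UNIV. \<xi> j z * (\<Sum>l | length l \<le> s. ?u j \<alpha> l))"
      unfolding sum_distrib_left by (rule sum.swap)
    finally show ?thesis .
  qed
  moreover have "total_diff {} no_system i f z =
      partial (Indep i) f z + (\<Sum>\<alpha>\<in>UNIV. \<Sum>l | length l \<le> s. ?u i \<alpha> l)" for i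
  proof -
    have "Sum_any (?u i \<alpha>) = (\<Sum>l | length l \<le> s. ?u i \<alpha> l)" for \<alpha>
      using assms by (intro Sum_any_length_le) simp
    then show ?thesis unfolding total_diff_def by simp
  qed
  moreover have "(\<Sum>\<alpha>\<in>UNIV. \<Sum>j\<in>UNIV. \<xi> j z * (\<Sum>l | length l \<le> s. ?u j \<alpha> l)) =
      (\<Sum>j\<in>UNIV. \<xi> j z * (\<Sum>\<alpha>\<in>UNIV. \<Sum>l | length l \<le> s. ?u j \<alpha> l))"
    unfolding sum_distrib_left[of "\<xi> _ z" "\<lambda>\<alpha>. \<Sum>l | length l \<le> s. _ \<alpha> l"] by (rule sum.swap)
  ultimately show ?thesis
    unfolding prolonged_field_def by (simp only: sum.distrib distrib_left)
qed

section \<open>Divergence on solutions of the vector with v eliminated\<close>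

theorem theorem0p8p2:
  fixes \<Omega> :: "('n::finite, 'm::finite, 'k) jet set"
    and F \<phi> :: "'b::finite \<Rightarrow> ('n, 'm, 'k) jet \<Rightarrow> real"
    and s :: nat
    and K :: "'k set"
    and G :: "'k \<Rightarrow> 'n \<Rightarrow> ('n, 'm, 'k) jet \<Rightarrow> real"
    and \<xi> :: "'n \<Rightarrow> ('n, 'm, 'k) jet \<Rightarrow> real"
    and \<eta> :: "'m \<Rightarrow> ('n, 'm, 'k) jet \<Rightarrow> real"
  assumes "open \<Omega>"
    and "\<And>b. locally_analytic_in (jet_vars s) \<Omega> (F b)"
    and "nonlinearly_self_adjoint \<Omega> F \<phi>"
    and "K = {} \<and> (lie_point_symmetry \<Omega> F \<xi> \<eta> \<or> contact_symmetry \<Omega> F \<xi> \<eta> \<or>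
                    lie_baecklund_symmetry \<Omega> F \<xi> \<eta>)
         \<or> nonlocal_symmetry \<Omega> F K G \<xi> \<eta>"
  shows "conservation_law \<Omega> F K G (conserved_vector F \<phi> K G \<xi> \<eta>)"
proof -
  have an: "differential_function \<Omega> UNIV f" if "locally_analytic_in V \<Omega> f" for V f
    using that by (rule differential_function.analytic) simp
  have K: "finite K" and \<xi>: "\<And>i. differential_function \<Omega> UNIV (\<xi> i)"
    and \<eta>: "\<And>\<alpha>. differential_function \<Omega> UNIV (\<eta> \<alpha>)"
    and G: "\<And>a i. a \<in> K \<Longrightarrow> differential_function \<Omega> UNIV (G a i)"
    and inv: "leaves_invariant \<Omega> F K G \<xi> \<eta>"
  proof -
    have "finite K \<and> (\<forall>i. \<exists>V. locally_analytic_in V \<Omega> (\<xi> i)) \<and>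
        (\<forall>\<alpha>. \<exists>V. locally_analytic_in V \<Omega> (\<eta> \<alpha>)) \<and>
        (\<forall>a\<in>K. \<forall>i. \<exists>V. locally_analytic_in V \<Omega> (G a i)) \<and> leaves_invariant \<Omega> F K G \<xi> \<eta>"
      using assms(4)
    proof
      assume *: "K = {} \<and> (lie_point_symmetry \<Omega> F \<xi> \<eta> \<or> contact_symmetry \<Omega> F \<xi> \<eta> \<or>
        lie_baecklund_symmetry \<Omega> F \<xi> \<eta>)"
      \<comment> \<open>\<open>G\<close> is arbitrary in this case, but there is no \<sigma> for it
        to act on, so invariance stated with \<open>no_system\<close> transfers to it.\<close>
      have "total_diff {} G = total_diff {} no_system"
        by (intro ext) (simp add: total_diff_def)
      then have "leaves_invariant \<Omega> F {} G \<xi> \<eta> = leaves_invariant \<Omega> F {} no_system \<xi> \<eta>"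
        unfolding leaves_invariant_def prolonged_field_def prolong_coeff_eq by simp
      with * show ?thesis
        unfolding lie_point_symmetry_def contact_symmetry_def lie_baecklund_symmetry_def by auto
    next
      assume "nonlocal_symmetry \<Omega> F K G \<xi> \<eta>"
      then show ?thesis
        unfolding nonlocal_symmetry_def nonlocal_system_def nonlocal_function_def by blast
    qed
    then show "finite K" "\<And>i. differential_function \<Omega> UNIV (\<xi> i)"
      "\<And>\<alpha>. differential_function \<Omega> UNIV (\<eta> \<alpha>)"
      "\<And>a i. a \<in> K \<Longrightarrow> differential_function \<Omega> UNIV (G a i)" "leaves_invariant \<Omega> F K G \<xi> \<eta>"
      using an by blast+
  qed
  note open_\<Omega> = assms(1)
  note fd = differential_function_finitely_differentiable[OF open_\<Omega>]
  have jet_vars_local: "jet_vars r \<subseteq> - range Nonloc" for r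
    unfolding jet_vars_def by auto
  have F: "differential_function \<Omega> (- range Nonloc) (F b)" for b
    using assms(2) jet_vars_local by (rule differential_function.analytic)
  have \<phi>: "differential_function \<Omega> (- range Nonloc) (\<phi> b)" for b
    using assms(3) jet_vars_local unfolding nonlinearly_self_adjoint_def
    by (intro differential_function.analytic[of "jet_vars 0"]) auto
  have to_UNIV: "differential_function \<Omega> UNIV f" if "differential_function \<Omega> (- range Nonloc) f" for f
    using that by (rule differential_function_mono) simp

  define W where "W = characteristic \<xi> \<eta>"
  have W: "differential_function \<Omega> UNIV (W \<alpha>)" for \<alpha>
    unfolding W_def characteristic_def[abs_def]
    by (intro differential_function_diff differential_function_sum differential_function.mult
        differential_function.coord \<xi> \<eta>) simp
  \<comment> \<open>The derivative of L by u_l after v = \<phi>.\<close>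
  define P where "P \<alpha> l z = (\<Sum>b\<in>UNIV. \<phi> b z * dpartial \<alpha> l (F b) z)" for \<alpha> l z
  have P: "differential_function \<Omega> (- range Nonloc) (P \<alpha> l)" for \<alpha> l
    unfolding P_def[abs_def]
    by (intro differential_function_sum differential_function.mult \<phi>
        differential_function_dpartial[OF open_\<Omega> F])
  have F_zero: "dpartial \<alpha> l (F b) z = 0" if "length l > s" "z \<in> \<Omega>" for \<alpha> l b z
    using that by (intro dpartial_determined_by[OF open_\<Omega> locally_analytic_inD(2)[OF assms(2)]])
      (auto simp: jet_vars_def)
  then have P_zero: "P \<alpha> l z = 0" if "length l > s" "z \<in> \<Omega>" for \<alpha> l z
    using that by (simp add: P_def)
  have P_mset: "P \<alpha> l = P \<alpha> l'" if "mset l = mset l'" for \<alpha> l l'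
    unfolding P_def[abs_def] dpartial_mset[OF that] ..
  define L\<^sub>0 where "L\<^sub>0 z = (\<Sum>b\<in>UNIV. \<phi> b z * F b z)" for z
  have L\<^sub>0: "differential_function \<Omega> UNIV L\<^sub>0"
    unfolding L\<^sub>0_def[abs_def]
    by (intro differential_function_sum differential_function.mult to_UNIV \<phi> F)
  \<comment> \<open>The cut at \<open>s\<close> comes from the order of F: for longer tuples
    \<open>P\<close> vanishes on \<open>\<Omega>\<close>. Agreement with the unrestricted sums is
    \<open>E_eq\<close>.\<close>
  define E where
    "E \<alpha> l z = (\<Sum>k | length k \<le> s. (- 1) ^ length k * total_diffs K G k (P \<alpha> (l @ k)) z)" for \<alpha> l z
  have D_zero: "total_diffs K G k (P \<alpha> l) z = 0" if "length l > s" "z \<in> \<Omega>" for k \<alpha> l z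
    using total_diffs_cong_open[OF open_\<Omega> that(2) P_zero[OF that(1)]] by simp

  \<comment> \<open>\<open>K'\<close> and \<open>G'\<close> are left free because the identity
    serves twice: with the nonlocal differentiations of \<open>conserved_vector_v\<close> and with
    the local ones of \<open>euler_lagrange\<close>.\<close>
  have D_lagrangian: "total_diffs K' G' k (dpartial (Inl \<alpha>) l (formal_lagrangian F)) (substitute_v \<phi> z)
      = total_diffs K G k (P \<alpha> l) z" if "finite K'" "z \<in> \<Omega>" for K' G' k \<alpha> l z
  proof -
    note sdF = differential_function_separately_differentiable[OF open_\<Omega> F]
    have "total_diffs K' G' k (dpartial (Inl \<alpha>) l (formal_lagrangian F)) (substitute_v \<phi> z) =
        total_diffs K' G' k (\<lambda>y. \<Sum>b\<in>UNIV. y (Dep (Inr b) {#}) * dpartial \<alpha> l (F b) (forget_v y))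
          (substitute_v \<phi> z)"
      using dpartial_formal_lagrangian[where F = F and \<alpha> = \<alpha> and l = l, OF open_\<Omega> sdF] that(2)
      by (intro total_diffs_cong_open[OF open_forget_v[OF open_\<Omega>]]) simp_all
    also have "\<dots> = total_diffs {} no_system k (P \<alpha> l) z"
      unfolding P_def[abs_def]
      by (intro linear_in_v_total_diffs_substitute[OF open_\<Omega> \<phi>] linear_in_v_sum[OF open_\<Omega> \<phi>] that
          differential_function_dpartial[OF open_\<Omega> F])
    also have "\<dots> = total_diffs K G k (P \<alpha> l) z"
      by (rule total_diffs_local[OF open_\<Omega> K P that(2), symmetric])
    finally show ?thesis .
  qed

  have E_eq: "Sum_any (\<lambda>k. (- 1) ^ length k * total_diffs K G k (P \<alpha> (l @ k)) z) = E \<alpha> l z"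
    if "z \<in> \<Omega>" for \<alpha> l z
    unfolding E_def using D_zero that by (intro Sum_any_length_le) simp
  have E_zero: "E \<alpha> l z = 0" if "length l > s" "z \<in> \<Omega>" for \<alpha> l z
    unfolding E_def using D_zero that by (intro sum.neutral) simp

  \<comment> \<open>Proved on all of \<open>\<Omega>\<close>, since it is differentiated below; the
    right-hand side is free of v.\<close>
  have C: "conserved_vector F \<phi> K G \<xi> \<eta> i z = \<xi> i z * L\<^sub>0 z
      + (\<Sum>\<alpha>\<in>UNIV. \<Sum>l | length l \<le> s. total_diffs K G l (W \<alpha>) z * E \<alpha> (i # l) z)"
    if z: "z \<in> \<Omega>" for i z
  proof -
    have "total_diffs K (\<lambda>a j. G a j \<circ> forget_v) l (W \<alpha> \<circ> forget_v) (substitute_v \<phi> z) =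
        total_diffs K G l (W \<alpha>) z" for l \<alpha>
      using total_diffs_forget_v[OF open_\<Omega> K W _ G, of "substitute_v \<phi> z"] z by simp
    moreover have "formal_lagrangian F (substitute_v \<phi> z) = L\<^sub>0 z"
      by (simp add: formal_lagrangian_def L\<^sub>0_def substitute_v_Inr)
    moreover have "Sum_any (\<lambda>l. total_diffs K G l (W \<alpha>) z * E \<alpha> (i # l) z) =
        (\<Sum>l | length l \<le> s. total_diffs K G l (W \<alpha>) z * E \<alpha> (i # l) z)" for \<alpha>
      using E_zero z by (intro Sum_any_length_le) simp
    ultimately show ?thesis
      unfolding conserved_vector_def conserved_vector_v_def Let_def W_def[symmetric]
      using E_eq[OF z, of _ "i # _"] by (simp add: D_lagrangian[OF K z])
  qed

  show ?thesis
    unfolding conservation_law_def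
  proof
    fix z assume sol: "z \<in> solution_set \<Omega> F"
    then have z: "z \<in> \<Omega>" and DF: "\<And>b l. total_diffs {} no_system l (F b) z = 0"
      unfolding solution_set_def by simp_all
    have Fz: "F b z = 0" and DFz: "total_diff {} no_system i (F b) z = 0" for b i
      using DF[of "[]" b] DF[of "[i]" b] by simp_all
    have L\<^sub>0z: "L\<^sub>0 z = 0" by (simp add: L\<^sub>0_def Fz)
    have dfD: "differential_function \<Omega> UNIV (total_diffs K G l f)"
      if "differential_function \<Omega> UNIV f" for l f
      by (rule differential_function_total_diffs[OF open_\<Omega> K that]) (auto intro: G)
    have dfE: "differential_function \<Omega> UNIV (E \<alpha> l)" for \<alpha> l
      unfolding E_def[abs_def]
      by (intro differential_function_sum differential_function.mult differential_function.const
          dfD to_UNIV P)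

    \<comment> \<open>Vanishing of \<open>L\<^sub>0\<close> on solutions would not suffice. By the
      Leibniz rule each term contains F or D_i(F), and both are zero at \<open>z\<close>.\<close>
    have DL\<^sub>0: "total_diff K G i L\<^sub>0 z = 0" for i
    proof -
      have "total_diff K G i L\<^sub>0 z = (\<Sum>b\<in>UNIV. total_diff K G i (\<lambda>z. \<phi> b z * F b z) z)"
        unfolding L\<^sub>0_def[abs_def]
        by (intro total_diff_sum[OF open_\<Omega> K _ z] finitely_differentiable_mult fd[OF \<phi>] fd[OF F])
      then show ?thesis
        by (simp add: total_diff_mult[OF open_\<Omega> K fd[OF \<phi>] fd[OF F] z] Fz
            total_diff_local[OF open_\<Omega> K F z] DFz)
    qed

    \<comment> \<open>The hypothesis concerns the local Euler-Lagrange expression at the substituted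
      point; \<open>D_lagrangian\<close> matches it with \<open>E\<close> term by term.\<close>
    have EL: "E \<alpha> [] z = 0" for \<alpha>
    proof -
      have "E \<alpha> [] z = euler_lagrange (Inl \<alpha>) (formal_lagrangian F) (substitute_v \<phi> z)"
        unfolding euler_lagrange_def E_eq[OF z, symmetric] by (simp add: D_lagrangian z)
      then show ?thesis
        using assms(3) sol unfolding nonlinearly_self_adjoint_def by simp
    qed

    have sym: "(\<Sum>\<alpha>\<in>UNIV. \<Sum>l | length l \<le> s. total_diffs K G l (W \<alpha>) z * dpartial \<alpha> l (F b) z) = 0" for b
      using inv sol prolonged_field_eq[where f = "F b" and K = K and G = G and \<xi> = \<xi> and \<eta> = \<eta>,
          OF F_zero[OF _ z]]
      unfolding leaves_invariant_def W_def by (simp add: DFz)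

    let ?S = "\<lambda>\<alpha> i z. \<Sum>l | length l \<le> s. total_diffs K G l (W \<alpha>) z * E \<alpha> (i # l) z"
    have dfS: "differential_function \<Omega> UNIV (?S \<alpha> i)" for \<alpha> i
      by (intro differential_function_sum differential_function.mult dfD W dfE)
    have "total_diff K G i (conserved_vector F \<phi> K G \<xi> \<eta> i) z =
        (\<Sum>\<alpha>\<in>UNIV. total_diff K G i (?S \<alpha> i) z)" for i
    proof -
      have "total_diff K G i (conserved_vector F \<phi> K G \<xi> \<eta> i) z =
          total_diff K G i (\<lambda>z. \<xi> i z * L\<^sub>0 z + (\<Sum>\<alpha>\<in>UNIV. ?S \<alpha> i z)) z"
        using open_\<Omega> z C by (rule total_diff_cong_open)
      also have "\<dots> = total_diff K G i (\<lambda>z. \<xi> i z * L\<^sub>0 z) z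
          + total_diff K G i (\<lambda>z. \<Sum>\<alpha>\<in>UNIV. ?S \<alpha> i z) z"
        by (intro total_diff_add[OF open_\<Omega> K _ _ z] finitely_differentiable_mult
            finitely_differentiable_sum fd[OF \<xi>] fd[OF L\<^sub>0] fd[OF dfS])
      also have "total_diff K G i (\<lambda>z. \<xi> i z * L\<^sub>0 z) z = 0"
        using total_diff_mult[OF open_\<Omega> K fd[OF \<xi>] fd[OF L\<^sub>0] z] by (simp add: L\<^sub>0z DL\<^sub>0)
      also have "total_diff K G i (\<lambda>z. \<Sum>\<alpha>\<in>UNIV. ?S \<alpha> i z) z =
          (\<Sum>\<alpha>\<in>UNIV. total_diff K G i (?S \<alpha> i) z)"
        by (rule total_diff_sum[OF open_\<Omega> K fd[OF dfS] z])
      finally show ?thesis by simp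
    qed
    then have "(\<Sum>i\<in>UNIV. total_diff K G i (conserved_vector F \<phi> K G \<xi> \<eta> i) z) =
        (\<Sum>i\<in>UNIV. \<Sum>\<alpha>\<in>UNIV. total_diff K G i (?S \<alpha> i) z)" by simp
    also have "\<dots> = (\<Sum>\<alpha>\<in>UNIV. \<Sum>i\<in>UNIV. total_diff K G i (?S \<alpha> i) z)"
      by (rule sum.swap)
    \<comment> \<open>The remaining term of the summation by parts is W times
      \<open>E \<alpha> []\<close>, zero by \<open>EL\<close>.\<close>
    also have "\<dots> = (\<Sum>\<alpha>\<in>UNIV. (\<Sum>l | length l \<le> s. total_diffs K G l (W \<alpha>) z * P \<alpha> l z))"
    proof (rule sum.cong[OF refl])
      fix \<alpha>
      show "(\<Sum>i\<in>UNIV. total_diff K G i (?S \<alpha> i) z) =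
          (\<Sum>l | length l \<le> s. total_diffs K G l (W \<alpha>) z * P \<alpha> l z)"
        using summation_by_parts[where w = "W \<alpha>" and P = "P \<alpha>",
            OF open_\<Omega> K W to_UNIV[OF P] G P_mset P_zero z]
          EL[of \<alpha>] unfolding E_def by simp
    qed
    \<comment> \<open>Expanding \<open>P\<close> and sorting by \<open>b\<close> produces \<phi>^b
      times the expression that \<open>sym\<close> shows to be zero.\<close>
    also have "\<dots> = (\<Sum>\<alpha>\<in>UNIV. \<Sum>l | length l \<le> s. \<Sum>b\<in>UNIV.
        \<phi> b z * (total_diffs K G l (W \<alpha>) z * dpartial \<alpha> l (F b) z))"
      by (simp add: P_def sum_distrib_left mult_ac)
    also have "\<dots> = (\<Sum>\<alpha>\<in>UNIV. \<Sum>b\<in>UNIV. \<Sum>l | length l \<le> s.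
        \<phi> b z * (total_diffs K G l (W \<alpha>) z * dpartial \<alpha> l (F b) z))"
      by (intro sum.cong refl sum.swap)
    also have "\<dots> = (\<Sum>b\<in>UNIV. \<Sum>\<alpha>\<in>UNIV. \<Sum>l | length l \<le> s.
        \<phi> b z * (total_diffs K G l (W \<alpha>) z * dpartial \<alpha> l (F b) z))"
      by (rule sum.swap)
    also have "\<dots> = (\<Sum>b\<in>UNIV. \<phi> b z * (\<Sum>\<alpha>\<in>UNIV. \<Sum>l | length l \<le> s.
        total_diffs K G l (W \<alpha>) z * dpartial \<alpha> l (F b) z))"
      by (simp only: sum_distrib_left)
    finally show "(\<Sum>i\<in>UNIV. total_diff K G i (conserved_vector F \<phi> K G \<xi> \<eta> i) z) = 0"
      by (simp add: sym)
  qed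
qed

end
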